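(* Let $d>4$, $0\le \eta<\frac12$, $0<\epsilon\le \frac{1}{4\pi}$ and $0<\delta\le\frac14$. For any active learning algorithm $\mathcal{A}$ there exist a unit vector $u\in\mathbb{S}^{d-1}$ and a labeling oracle $\mathcal{O}$ satisfying the $\eta$-bounded noise condition with respect to $u$ such that the following holds: if, with probability at least $1-\delta$, $\mathcal{A}$ makes at most $n$ label queries to $\mathcal{O}$ and outputs $v\in\mathbb{S}^{d-1}$ with $\mathbb{P}_{X}[\operatorname{sign}(v\cdot X)\neq \operatorname{sign}(u\cdot X)]\le\epsilon$ (where $X$ is uniform on $\mathbb{S}^{d-1}$), then $$n\ \ge\ \Omega\!\left(\frac{d\log\frac1\epsilon}{(1-2\eta)^2}+\frac{\eta\log\frac1\delta}{(1-2\eta)^2}\right).$$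
   Context: $\mathbb{S}^{d-1}=\{x\in\mathbb{R}^d:\|x\|=1\}$. Data $(X,Y)\in\mathbb{S}^{d-1}\times\{-1,+1\}$ follow a distribution whose marginal on $X$ is uniform on $\mathbb{S}^{d-1}$. A labeling oracle $\mathcal{O}$, when queried at $x$, returns a label $y$ drawn from the conditional distribution of $Y$ given $X=x$. An active learning algorithm sequentially chooses query points (each may depend on all previous query points and returned labels and on internal randomness), queries $\mathcal{O}$ for their labels, and finally outputs a unit vector. The oracle satisfies the $\eta$-bounded noise condition with respect to $u$ if for every $x$, $\mathbb{P}[Y\neq\operatorname{sign}(u\cdot x)\mid X=x]\le\eta$. The $\Omega$ hides an absolute constant. *)

theory Defs
  imports "HOL-Probability.Probability"
begin

(* Vectors of R^d are represented as functions nat => real; only the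
   coordinates 0..d-1 matter. *)

definition dotd :: "nat \<Rightarrow> (nat \<Rightarrow> real) \<Rightarrow> (nat \<Rightarrow> real) \<Rightarrow> real" where
  "dotd d x y = (\<Sum>i<d. x i * y i)"

definition sphere_d :: "nat \<Rightarrow> (nat \<Rightarrow> real) set" where
  "sphere_d d = {x. (\<forall>i\<ge>d. x i = 0) \<and> (\<Sum>i<d. (x i)\<^sup>2) = 1}"

definition sgnp :: "real \<Rightarrow> real" where
  "sgnp z = (if z \<ge> 0 then 1 else -1)"

definition gauss_d :: "nat \<Rightarrow> (nat \<Rightarrow> real) measure" where
  "gauss_d d = PiM {..<d} (\<lambda>_. density lborel std_normal_density)"

definition unif_sphere :: "nat \<Rightarrow> (nat \<Rightarrow> real) measure" where
  "unif_sphere d = distr (gauss_d d) (PiM {..<d} (\<lambda>_. borel))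
     (\<lambda>g. restrict (\<lambda>i. g i / sqrt (\<Sum>j<d. (g j)\<^sup>2)) {..<d})"

definition disagree :: "nat \<Rightarrow> (nat \<Rightarrow> real) \<Rightarrow> (nat \<Rightarrow> real) \<Rightarrow> real" where
  "disagree d v u = measure (unif_sphere d)
     {x \<in> space (unif_sphere d). sgnp (dotd d v x) \<noteq> sgnp (dotd d u x)}"

(* A labeling oracle is given by p x = P[Y = +1 | X = x]; it satisfies the
   eta-bounded noise condition w.r.t. u if P[Y ~= sign(u.x) | X = x] <= eta
   for every x. *)
definition bounded_noise_oracle ::
    "nat \<Rightarrow> real \<Rightarrow> (nat \<Rightarrow> real) \<Rightarrow> ((nat \<Rightarrow> real) \<Rightarrow> real) \<Rightarrow> bool" where
  "bounded_noise_oracle d \<eta> u p \<longleftrightarrow>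
     p \<in> borel_measurable borel \<and>
     (\<forall>x. 0 \<le> p x \<and> p x \<le> 1 \<and>
          (if sgnp (dotd d u x) = 1 then 1 - p x else p x) \<le> \<eta>)"

(* The oracle's answer at x, using a fresh uniform [0,1] variable xi:
   +1 with probability p x, -1 otherwise. *)
definition oracle_label :: "((nat \<Rightarrow> real) \<Rightarrow> real) \<Rightarrow> (nat \<Rightarrow> real) \<Rightarrow> real \<Rightarrow> real" where
  "oracle_label p x \<xi> = (if \<xi> < p x then 1 else -1)"

(* An active learning algorithm: given its internal random seed and the
   history of (query point, label) pairs, it either queries a point or
   outputs a vector and stops. *)
datatype action = Query "nat \<Rightarrow> real" | Output "nat \<Rightarrow> real"

type_synonym algorithm = "(nat \<Rightarrow> real) \<Rightarrow> ((nat \<Rightarrow> real) \<times> real) list \<Rightarrow> action"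

fun hist :: "algorithm \<Rightarrow> ((nat \<Rightarrow> real) \<Rightarrow> real) \<Rightarrow> (nat \<Rightarrow> real) \<Rightarrow> (nat \<Rightarrow> real)
             \<Rightarrow> nat \<Rightarrow> ((nat \<Rightarrow> real) \<times> real) list" where
  "hist A p r \<xi> 0 = []"
| "hist A p r \<xi> (Suc k) =
     (let h = hist A p r \<xi> k in
      if length h = k then
        (case A r h of Query x \<Rightarrow> h @ [(x, oracle_label p x (\<xi> k))] | Output v \<Rightarrow> h)
      else h)"

(* source of randomness: i.i.d. uniform [0,1] sequences for the algorithm's
   internal coins and for the oracle's label noise *)
definition unif_seq :: "(nat \<Rightarrow> real) measure" where
  "unif_seq = PiM UNIV (\<lambda>_::nat. uniform_measure lborel {0..1::real})"

definition run_space :: "((nat \<Rightarrow> real) \<times> (nat \<Rightarrow> real)) measure" where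
  "run_space = unif_seq \<Otimes>\<^sub>M unif_seq"

definition success_event ::
    "nat \<Rightarrow> algorithm \<Rightarrow> ((nat \<Rightarrow> real) \<Rightarrow> real) \<Rightarrow> (nat \<Rightarrow> real) \<Rightarrow> real \<Rightarrow> nat
     \<Rightarrow> ((nat \<Rightarrow> real) \<times> (nat \<Rightarrow> real)) set" where
  "success_event d A p u \<epsilon> n = {(r, \<xi>) \<in> space run_space.
      \<exists>v. A r (hist A p r \<xi> n) = Output v \<and> v \<in> sphere_d d \<and> disagree d v u \<le> \<epsilon>}"

end

theory Submission
  imports Defs
begin

text \<open>
  Fix the internal randomness: an algorithm making at most \<open>n\<close> queries becomes a decision tree, and the
  law of its final history under an oracle \<open>p\<close> is a product of label probabilities along the
  branch. The chi-square divergence between two such laws is then at most \<open>B ^ n\<close>, where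
  \<open>B\<close> bounds the one-label divergence, however adaptive the queries are.

  Given a packing \<open>U\<close> of directions at pairwise disagreement above \<open>2 * \<epsilon>\<close>, success for
  different \<open>u\<close> in \<open>U\<close> means ending in disjoint sets of histories. Comparing every
  \<open>u\<close> with fair coin labels, where \<open>B = 1 + (1 - 2 * \<eta>)\<^sup>2\<close>, gives
  \<open>9/16 * card U \<le> B ^ n\<close> and hence the term in \<open>d * ln (1/\<epsilon>)\<close>; comparing two members of
  \<open>U\<close> with each other, where \<open>B = 1 + (1 - 2 * \<eta>)\<^sup>2 / (\<eta> * (1 - \<eta>))\<close>, gives
  \<open>1 \<le> 2 * \<delta> * B ^ n\<close> and hence the term in \<open>ln (1/\<delta>)\<close>.

  The packing consists of the directions \<open>(1, t)\<close>, normalised, with \<open>t\<close> running through a code of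
  relative Hamming distance \<open>1/4\<close> in a grid with \<open>K\<close> values per coordinate. Conditionally on the
  other coordinates of a Gaussian vector, the disagreement of \<open>(1, t)\<close> and \<open>(1, s)\<close> is the
  Gaussian measure of an interval between two linear forms.
\<close>

subsection \<open>Histories and change of measure\<close>

text \<open>The leaves of the decision tree for a fixed seed. Both answers to every query are
  followed, so the set depends on no oracle. As in \<open>hist\<close>, a length below
  \<open>k\<close> marks a run that has stopped.\<close>

fun histories :: "(((nat \<Rightarrow> real) \<times> real) list \<Rightarrow> action) \<Rightarrow> nat \<Rightarrow> ((nat \<Rightarrow> real) \<times> real) list set" where
  "histories f 0 = {[]}"
| "histories f (Suc k) = (\<Union>h\<in>histories f k. case f h of
      Query x \<Rightarrow> if length h = k then {h @ [(x, 1)], h @ [(x, -1)]} else {h}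
    | Output v \<Rightarrow> {h})"

definition label_prob :: "((nat \<Rightarrow> real) \<Rightarrow> real) \<Rightarrow> (nat \<Rightarrow> real) \<times> real \<Rightarrow> real" where
  "label_prob p z = (if snd z = 1 then p (fst z) else 1 - p (fst z))"

text \<open>The likelihood of a history under the oracle \<open>p\<close> once the seed is fixed.
  Query points contribute no factor, being determined by the earlier labels.\<close>

definition weight :: "((nat \<Rightarrow> real) \<Rightarrow> real) \<Rightarrow> ((nat \<Rightarrow> real) \<times> real) list \<Rightarrow> real" where
  "weight p h = prod_list (map (label_prob p) h)"

lemma weight_Nil [simp]: "weight p [] = 1"
  and weight_snoc [simp]: "weight p (h @ [z]) = weight p h * label_prob p z"
  by (simp_all add: weight_def)

lemma finite_histories [simp]: "finite (histories f n)"
  by (induction n) (auto split: action.splits)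

lemma hist_in_histories: "hist A p r \<xi> n \<in> histories (A r) n"
proof (induction n)
  case (Suc n)
  then show ?case
    by (auto simp: Let_def oracle_label_def split: action.split
        intro!: bexI[of _ "hist A p r \<xi> n"])
qed simp

text \<open>Subadditivity spares a proof that different leaves of the tree have disjoint
  children.\<close>

lemma sum_UN_le_real:
  fixes F :: "'b \<Rightarrow> real"
  assumes "finite I" "\<And>i. i \<in> I \<Longrightarrow> finite (S i)" "\<And>x. 0 \<le> F x"
  shows "sum F (\<Union>i\<in>I. S i) \<le> (\<Sum>i\<in>I. sum F (S i))"
  using assms(1,2)
proof (induction I rule: finite_induct)
  case (insert i I)
  have "sum F (S i \<union> (\<Union>i\<in>I. S i)) \<le> sum F (S i) + sum F (\<Union>i\<in>I. S i)"
    using insert assms(3) sum.union_inter[of "S i" "\<Union>i\<in>I. S i" F]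
      sum_nonneg[of "S i \<inter> (\<Union>i\<in>I. S i)" F]
    by fastforce
  then show ?case using insert by fastforce
qed simp

lemma weight_nonneg: "(\<And>x. 0 \<le> p x \<and> p x \<le> 1) \<Longrightarrow> 0 \<le> weight p h"
  unfolding weight_def label_prob_def by (induction h) auto

lemma weight_pos: "(\<And>x. 0 < p x \<and> p x < 1) \<Longrightarrow> 0 < weight p h"
  unfolding weight_def label_prob_def by (induction h) auto

text \<open>For an oracle \<open>p\<close> the sum is one plus the chi-square divergence. A query
  splits a leaf in two and multiplies its term by at most \<open>B\<close>, whatever the point
  queried; a stopped leaf stays, which is where \<open>1 \<le> B\<close> enters.\<close>

lemma chi_square_histories:
  assumes q: "\<And>x. 0 < q x \<and> q x < 1"
    and B: "1 \<le> B" "\<And>x. (p x)\<^sup>2 / q x + (1 - p x)\<^sup>2 / (1 - q x) \<le> B"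
  shows "(\<Sum>h\<in>histories f n. (weight p h)\<^sup>2 / weight q h) \<le> B ^ n"
proof (induction n)
  case (Suc n)
  define F where "F h = (weight p h)\<^sup>2 / weight q h" for h
  have F0: "0 \<le> F h" for h
    using weight_pos[of q h, OF q] by (simp add: F_def)
  define S where "S h = (case f h of
      Query x \<Rightarrow> if length h = n then {h @ [(x, 1)], h @ [(x, -1)]} else {h}
    | Output v \<Rightarrow> {h})" for h
  have S: "sum F (S h) \<le> B * F h" for h
  proof -
    have "F h \<le> B * F h"
      using F0[of h] B(1) by (simp add: mult_le_cancel_right1)
    moreover have "F (h @ [(x, 1)]) + F (h @ [(x, -1)]) \<le> B * F h" for x
    proof -
      have "F (h @ [(x, 1)]) + F (h @ [(x, -1)])
          = ((p x)\<^sup>2 / q x + (1 - p x)\<^sup>2 / (1 - q x)) * F h"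
        by (simp add: F_def label_prob_def power_mult_distrib distrib_left add_divide_distrib mult.commute)
      also have "\<dots> \<le> B * F h"
        using B(2) F0 by (rule mult_right_mono)
      finally show ?thesis .
    qed
    ultimately show ?thesis by (auto simp: S_def split: action.split)
  qed
  have "sum F (histories f (Suc n)) = sum F (\<Union>h\<in>histories f n. S h)"
    by (simp add: S_def)
  also have "\<dots> \<le> (\<Sum>h\<in>histories f n. sum F (S h))"
    by (rule sum_UN_le_real) (auto simp: S_def F0 split: action.split)
  also have "\<dots> \<le> (\<Sum>h\<in>histories f n. B * F h)"
    by (intro sum_mono S)
  also have "\<dots> = B * sum F (histories f n)"
    by (simp add: sum_distrib_left)
  also have "\<dots> \<le> B * B ^ n"
    using Suc B(1) by (intro mult_left_mono) (auto simp: F_def)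
  finally show ?case by (simp add: F_def)
qed simp

text \<open>With \<open>p = q\<close> and \<open>B = 1\<close> the terms of the chi-square sum are
  the weights themselves, so that bound already controls the total mass.\<close>

lemma sum_weight_le_1:
  assumes q: "\<And>x. 0 < q x \<and> q x < 1" and "S \<subseteq> histories f n"
  shows "sum (weight q) S \<le> 1"
proof -
  have "sum (weight q) S \<le> sum (weight q) (histories f n)"
    using assms weight_pos[of q, OF q] by (intro sum_mono2) (auto simp: less_imp_le)
  also have "\<dots> = (\<Sum>h\<in>histories f n. (weight q h)\<^sup>2 / weight q h)"
    by (simp add: power2_eq_square)
  also have "\<dots> \<le> 1 ^ n"
    using q by (intro chi_square_histories) (auto simp: power2_eq_square less_imp_neq[symmetric])
  finally show ?thesis by simp
qed

text \<open>Cauchy-Schwarz in the linearised form of AM-GM. Being linear in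
  \<open>sum (weight q) S\<close>, the bound can be summed over hypotheses and averaged over seeds
  with one fixed \<kappa>.\<close>

lemma change_of_measure:
  assumes q: "\<And>x. 0 < q x \<and> q x < 1"
    and B: "1 \<le> B" "\<And>x. (p x)\<^sup>2 / q x + (1 - p x)\<^sup>2 / (1 - q x) \<le> B"
    and S: "S \<subseteq> histories f n" and \<kappa>: "0 < \<kappa>"
  shows "sum (weight p) S \<le> (\<kappa> * B ^ n + sum (weight q) S / \<kappa>) / 2"
proof -
  have *: "weight p h \<le> (\<kappa> * ((weight p h)\<^sup>2 / weight q h) + weight q h / \<kappa>) / 2" for h
  proof -
    note w = weight_pos[of q h, OF q]
    have "0 \<le> (\<kappa> * weight p h - weight q h)\<^sup>2 / (2 * \<kappa> * weight q h)"
      using w \<kappa> by simp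
    also have "\<dots> = (\<kappa> * ((weight p h)\<^sup>2 / weight q h) + weight q h / \<kappa>) / 2 - weight p h"
      using w \<kappa> by (simp add: power2_eq_square field_simps)
    finally show ?thesis by simp
  qed
  have "sum (weight p) S \<le> (\<Sum>h\<in>S. (\<kappa> * ((weight p h)\<^sup>2 / weight q h) + weight q h / \<kappa>) / 2)"
    by (intro sum_mono *)
  also have "\<dots> = (\<kappa> * (\<Sum>h\<in>S. (weight p h)\<^sup>2 / weight q h) + sum (weight q) S / \<kappa>) / 2"
    by (simp add: sum.distrib sum_distrib_left flip: sum_divide_distrib)
  also have "(\<Sum>h\<in>S. (weight p h)\<^sup>2 / weight q h) \<le> (\<Sum>h\<in>histories f n. (weight p h)\<^sup>2 / weight q h)"
    using S weight_pos[of q, OF q] by (intro sum_mono2) (auto simp: less_imp_le)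
  also have "\<dots> \<le> B ^ n"
    by (rule chi_square_histories[OF q B])
  finally show ?thesis using \<kappa> by (simp add: divide_right_mono)
qed

section \<open>Probability of a history under random labels\<close>

lemma prob_space_unif_interval: "prob_space (uniform_measure lborel {0..1::real})"
  by (rule prob_space_uniform_measure) auto

lemma prob_space_unif_seq: "prob_space unif_seq"
  unfolding unif_seq_def by (intro prob_space_PiM prob_space_unif_interval)

lemma space_unif_seq [simp]: "space unif_seq = UNIV"
  by (simp add: unif_seq_def space_PiM)

lemma measure_unif_interval_label:
  assumes "0 \<le> c" "c \<le> 1"
  shows "measure (uniform_measure lborel {0..1::real}) {\<xi>. (\<xi> < c) = b} = (if b then c else 1 - c)"
proof -
  have "{0..1} \<inter> {\<xi>. (\<xi> < c) = b} = (if b then {0..<c} else {c..1})"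
    using assms by auto
  then have "measure (uniform_measure lborel {0..1::real}) {\<xi>. (\<xi> < c) = b}
      = measure lborel (if b then {0..<c} else {c..1})"
    by (subst measure_uniform_measure) auto
  then show ?thesis using assms by auto
qed

text \<open>The algorithm is an arbitrary function, so events about its history need not be measurable;
  for a fixed seed, each history confines \<open>\<xi>\<close> to a measurable box.\<close>

lemma measure_hist_le:
  assumes p: "\<And>x. 0 \<le> p x \<and> p x \<le> 1"
  shows "\<exists>X\<in>sets unif_seq. {\<xi>. hist A p r \<xi> n = h} \<subseteq> X \<and> measure unif_seq X \<le> weight p h"
proof (cases "\<exists>\<xi>. hist A p r \<xi> n = h")
  case False
  then show ?thesis by (intro bexI[of _ "{}"]) (auto simp: weight_nonneg[OF p])
next
  case True
  then obtain \<xi>0 where \<xi>0: "hist A p r \<xi>0 n = h" by blast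
  let ?M = "\<lambda>_::nat. uniform_measure lborel {0..1::real}"
  interpret product_prob_space ?M UNIV
    by (intro product_prob_spaceI prob_space_unif_interval)
  \<comment> \<open>\<open>X i\<close> is the side of the threshold on which \<open>\<xi> i\<close>
    must lie to produce the label at position \<open>i\<close>; the threshold depends only on the
    query point recorded in \<open>h\<close>.\<close>
  define X where "X i = {\<xi>::real. (\<xi> < p (fst (h ! i))) = (snd (h ! i) = 1)}" for i
  have Xs: "X i \<in> sets (?M i)" for i
    unfolding X_def by simp
  have "\<forall>i<length h. (\<xi> i < p (fst (h ! i))) = (snd (h ! i) = 1)"
    if "hist A p r \<xi> n = h" for \<xi>
    using that
  proof (induction n arbitrary: h)
    case (Suc n)
    then show ?case
      by (auto simp: Let_def oracle_label_def nth_append less_Suc_eq split: action.splits if_splits)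
  qed simp
  then have sub: "{\<xi>. hist A p r \<xi> n = h} \<subseteq> prod_emb UNIV ?M {..<length h} (Pi\<^sub>E {..<length h} X)"
    by (auto simp: prod_emb_def X_def)
  have "measure unif_seq (prod_emb UNIV ?M {..<length h} (Pi\<^sub>E {..<length h} X))
      = (\<Prod>i<length h. measure (?M i) (X i))"
    unfolding unif_seq_def using Xs by (intro measure_PiM_emb) auto
  also have "\<dots> = (\<Prod>i<length h. label_prob p (h ! i))"
    unfolding X_def label_prob_def using p
    by (intro prod.cong refl, subst measure_unif_interval_label) auto
  also have "\<dots> = weight p h"
    by (simp add: weight_def prod.list_conv_set_nth atLeast0LessThan)
  finally show ?thesis
    using sub Xs
    by (intro bexI[of _ "prod_emb UNIV ?M {..<length h} (Pi\<^sub>E {..<length h} X)"])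
      (auto simp: unif_seq_def intro!: sets_PiM_I)
qed

text \<open>A union bound over the boxes that cover the histories in \<open>S\<close>, so only
  \<open>E\<close> has to be measurable.\<close>

lemma measure_hist_in_le:
  assumes p: "\<And>x. 0 \<le> p x \<and> p x \<le> 1"
    and E: "E \<in> sets unif_seq" "\<And>\<xi>. \<xi> \<in> E \<Longrightarrow> hist A p r \<xi> n \<in> S"
    and S: "finite S"
  shows "measure unif_seq E \<le> sum (weight p) S"
proof -
  interpret prob_space unif_seq by (rule prob_space_unif_seq)
  obtain X where X: "\<And>h. X h \<in> sets unif_seq" "\<And>h. {\<xi>. hist A p r \<xi> n = h} \<subseteq> X h"
      "\<And>h. measure unif_seq (X h) \<le> weight p h"
    using measure_hist_le[of p A r n, OF p] by metis
  have "E \<subseteq> (\<Union>h\<in>S. X h)" using E(2) X(2) by blast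
  then have "measure unif_seq E \<le> measure unif_seq (\<Union>h\<in>S. X h)"
    using X S by (intro finite_measure_mono) auto
  also have "\<dots> \<le> (\<Sum>h\<in>S. measure unif_seq (X h))"
    using X S by (intro finite_measure_subadditive_finite) auto
  also have "\<dots> \<le> sum (weight p) S" by (intro sum_mono X)
  finally show ?thesis .
qed

text \<open>Fubini reduces randomised algorithms to deterministic ones. A weighted sum is bounded
  because, for a single seed, only the combination over all hypotheses is controlled: one seed may
  favour one \<open>u\<close>.\<close>

lemma sum_measure_run_space_le:
  assumes U: "finite U" "\<And>u. u \<in> U \<Longrightarrow> 0 \<le> c u" "\<And>u. u \<in> U \<Longrightarrow> E u \<in> sets run_space"
    and K: "\<And>r. (\<Sum>u\<in>U. c u * measure unif_seq (Pair r -` E u)) \<le> K"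
  shows "(\<Sum>u\<in>U. c u * measure run_space (E u)) \<le> K"
proof -
  interpret Q: prob_space unif_seq by (rule prob_space_unif_seq)
  have meas: "(\<lambda>r. measure unif_seq (Pair r -` E u)) \<in> borel_measurable unif_seq" if "u \<in> U" for u
    using Q.measurable_emeasure_Pair[of "E u" unif_seq] U(3)[OF that]
    unfolding run_space_def measure_def by measurable
  have int: "integrable unif_seq (\<lambda>r. measure unif_seq (Pair r -` E u))" if "u \<in> U" for u
    using meas[OF that] by (intro Q.integrable_const_bound[of _ 1]) auto
  have eq: "measure run_space (E u) = (\<integral>r. measure unif_seq (Pair r -` E u) \<partial>unif_seq)"
    if "u \<in> U" for u
  proof -
    have "emeasure run_space (E u) = (\<integral>\<^sup>+ r. emeasure unif_seq (Pair r -` E u) \<partial>unif_seq)"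
      unfolding run_space_def using U(3)[OF that]
      by (intro Q.emeasure_pair_measure_alt) (simp add: run_space_def)
    also have "\<dots> = ennreal (\<integral>r. measure unif_seq (Pair r -` E u) \<partial>unif_seq)"
      using int[OF that] by (simp add: Q.emeasure_eq_measure nn_integral_eq_integral)
    finally show ?thesis
      by (simp add: measure_def integral_nonneg_AE)
  qed
  have "(\<Sum>u\<in>U. c u * measure run_space (E u))
      = (\<integral>r. (\<Sum>u\<in>U. c u * measure unif_seq (Pair r -` E u)) \<partial>unif_seq)"
    using int by (simp add: eq)
  also have "\<dots> \<le> (\<integral>r. K \<partial>unif_seq)"
    using int K by (intro integral_mono) auto
  also have "\<dots> = K" using Q.prob_space by simp
  finally show ?thesis .
qed

lemma hist_stable: "A r (hist A p r \<xi> n) = Output v \<Longrightarrow> hist A p r \<xi> (n + k) = hist A p r \<xi> n"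
  by (induction k) (auto simp: Let_def)

lemma success_event_mono: "n \<le> m \<Longrightarrow> success_event d A p u \<epsilon> n \<subseteq> success_event d A p u \<epsilon> m"
  by (auto simp: success_event_def le_iff_add hist_stable)

subsection \<open>Testing hypotheses about the direction\<close>

lemma borel_measurable_sgnp [measurable]: "sgnp \<in> borel_measurable borel"
  unfolding sgnp_def by measurable

lemma dotd_measurable_PiM [measurable]: "dotd d u \<in> borel_measurable (PiM {..<d} (\<lambda>_. borel))"
  unfolding dotd_def by measurable

lemma prob_space_gauss_d: "prob_space (gauss_d d)"
  unfolding gauss_d_def by (intro prob_space_PiM prob_space_normal_density) simp

lemma sets_gauss_d [measurable_cong]: "sets (gauss_d d) = sets (PiM {..<d} (\<lambda>_. borel))"
  unfolding gauss_d_def by (intro sets_PiM_cong) auto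

lemma normalize_measurable [measurable]:
  "(\<lambda>g. restrict (\<lambda>i. g i / sqrt (\<Sum>j<d. (g j)\<^sup>2)) {..<d})
     \<in> gauss_d d \<rightarrow>\<^sub>M PiM {..<d} (\<lambda>_. borel :: real measure)"
  by measurable

lemma prob_space_unif_sphere: "prob_space (unif_sphere d)"
  unfolding unif_sphere_def by (intro prob_space.prob_space_distr prob_space_gauss_d) measurable

lemma sets_unif_sphere [measurable_cong]: "sets (unif_sphere d) = sets (PiM {..<d} (\<lambda>_. borel))"
  by (simp add: unif_sphere_def)

lemma disagree_commute: "disagree d u v = disagree d v u"
  by (simp add: disagree_def eq_commute)

text \<open>Where \<open>u\<close> and \<open>w\<close> give different signs, \<open>v\<close> must
  differ from one of them.\<close>

lemma disagree_triangle: "disagree d u w \<le> disagree d u v + disagree d v w"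
proof -
  interpret prob_space "unif_sphere d" by (rule prob_space_unif_sphere)
  let ?D = "\<lambda>a b. {x \<in> space (unif_sphere d). sgnp (dotd d a x) \<noteq> sgnp (dotd d b x)}"
  have m: "?D a b \<in> sets (unif_sphere d)" for a b
  proof -
    have f: "(\<lambda>x. sgnp (dotd d a x)) \<in> borel_measurable (unif_sphere d)" for a
      by measurable
    show ?thesis using borel_measurable_neq[OF f f] .
  qed
  have "prob (?D u w) \<le> prob (?D u v \<union> ?D v w)"
    using m by (intro finite_measure_mono) auto
  also have "\<dots> \<le> prob (?D u v) + prob (?D v w)"
    using m by (intro measure_Un_le) auto
  finally show ?thesis by (simp add: disagree_def)
qed

text \<open>Success is expressed by the final history alone, free of oracle and noise, so that one
  set can be weighed under several oracles.\<close>

definition success_histories ::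
    "nat \<Rightarrow> (((nat \<Rightarrow> real) \<times> real) list \<Rightarrow> action) \<Rightarrow> (nat \<Rightarrow> real) \<Rightarrow> real \<Rightarrow> nat
     \<Rightarrow> ((nat \<Rightarrow> real) \<times> real) list set" where
  "success_histories d f u \<epsilon> n = {h \<in> histories f n. \<exists>v. f h = Output v \<and> disagree d v u \<le> \<epsilon>}"

lemma success_histories_subset: "success_histories d f u \<epsilon> n \<subseteq> histories f n"
  by (auto simp: success_histories_def)

lemma finite_success_histories [simp]: "finite (success_histories d f u \<epsilon> n)"
  by (rule finite_subset[OF success_histories_subset]) simp

text \<open>A single output within \<epsilon> of both directions would contradict the triangle
  inequality.\<close>

lemma disjoint_success_histories:
  assumes "2 * \<epsilon> < disagree d u u'"
  shows "success_histories d f u \<epsilon> n \<inter> success_histories d f u' \<epsilon> n = {}"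
proof -
  have "\<not> (disagree d v u \<le> \<epsilon> \<and> disagree d v u' \<le> \<epsilon>)" for v
    using disagree_triangle[of d u u' v] assms by (simp add: disagree_commute[of d u v])
  then show ?thesis
    by (auto simp: success_histories_def)
qed

lemma measure_success_section_le:
  assumes p: "\<And>x. 0 \<le> p x \<and> p x \<le> 1"
    and E: "E \<in> sets run_space" "E \<subseteq> success_event d A p u \<epsilon> n"
  shows "measure unif_seq (Pair r -` E) \<le> sum (weight p) (success_histories d (A r) u \<epsilon> n)"
proof (rule measure_hist_in_le[OF p])
  show "Pair r -` E \<in> sets unif_seq"
    using E(1) by (auto simp: run_space_def intro: sets_Pair1)
  show "hist A p r \<xi> n \<in> success_histories d (A r) u \<epsilon> n" if "\<xi> \<in> Pair r -` E" for \<xi>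
    using that E(2) by (auto simp: success_histories_def success_event_def hist_in_histories)
qed simp

text \<open>Under fair coin labels the disjoint success sets share total mass at most 1, yet each
  has mass at least \<open>3/4\<close> under its own oracle; only a large divergence can reconcile
  this for many \<open>u\<close>.\<close>

lemma many_hypotheses:
  assumes U: "finite U" "\<And>u u'. u \<in> U \<Longrightarrow> u' \<in> U \<Longrightarrow> u \<noteq> u' \<Longrightarrow> 2 * \<epsilon> < disagree d u u'"
    and p: "\<And>u x. 0 \<le> p u x \<and> p u x \<le> 1"
    and B: "1 \<le> B" "\<And>u x. 2 * (p u x)\<^sup>2 + 2 * (1 - p u x)\<^sup>2 \<le> B"
    and E: "\<And>u. u \<in> U \<Longrightarrow> E u \<in> sets run_space"
      "\<And>u. u \<in> U \<Longrightarrow> E u \<subseteq> success_event d A (p u) u \<epsilon> n"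
      "\<And>u. u \<in> U \<Longrightarrow> 3 / 4 \<le> measure run_space (E u)"
  shows "9 / 16 * real (card U) \<le> B ^ n"
proof -
  define q :: "(nat \<Rightarrow> real) \<Rightarrow> real" where "q = (\<lambda>_. 1 / 2)"
  \<comment> \<open>With this choice the first term in \<open>change_of_measure\<close> is
    \<open>3/8\<close>, half of the assumed success probability, so the other half remains to be
    paid by \<open>B ^ n\<close>.\<close>
  define \<kappa> where "\<kappa> = 3 / (4 * B ^ n)"
  have Bn: "0 < B ^ n" and \<kappa>: "0 < \<kappa>" using B(1) by (auto simp: \<kappa>_def)
  define K where "K = (\<kappa> * real (card U) * B ^ n + 1 / \<kappa>) / 2"
  have "(\<Sum>u\<in>U. 1 * measure unif_seq (Pair r -` E u)) \<le> K" for r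
  proof -
    let ?S = "\<lambda>u. success_histories d (A r) u \<epsilon> n"
    have "(\<Sum>u\<in>U. 1 * measure unif_seq (Pair r -` E u)) \<le> (\<Sum>u\<in>U. (\<kappa> * B ^ n + sum (weight q) (?S u) / \<kappa>) / 2)"
    proof (rule sum_mono)
      fix u assume u: "u \<in> U"
      have "measure unif_seq (Pair r -` E u) \<le> sum (weight (p u)) (?S u)"
        using u by (intro measure_success_section_le p E)
      also have "\<dots> \<le> (\<kappa> * B ^ n + sum (weight q) (?S u) / \<kappa>) / 2"
        using B \<kappa> by (intro change_of_measure[OF _ _ _ success_histories_subset])
          (auto simp: q_def field_simps)
      finally show "1 * measure unif_seq (Pair r -` E u) \<le> (\<kappa> * B ^ n + sum (weight q) (?S u) / \<kappa>) / 2"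
        by simp
    qed
    also have "\<dots> = (\<kappa> * real (card U) * B ^ n + (\<Sum>u\<in>U. sum (weight q) (?S u)) / \<kappa>) / 2"
      by (simp add: sum.distrib flip: sum_divide_distrib)
    also have "(\<Sum>u\<in>U. sum (weight q) (?S u)) = sum (weight q) (\<Union>u\<in>U. ?S u)"
      using U by (intro sum.UNION_disjoint[symmetric])
        (auto dest: disjoint_success_histories)
    also have "\<dots> \<le> 1"
      by (rule sum_weight_le_1[of _ _ "A r" n]) (auto simp: q_def success_histories_def)
    finally show ?thesis using \<kappa> by (simp add: K_def divide_right_mono)
  qed
  then have "(\<Sum>u\<in>U. 1 * measure run_space (E u)) \<le> K"
    using U E by (intro sum_measure_run_space_le) auto
  moreover have "(\<Sum>u\<in>U. 3 / 4) \<le> (\<Sum>u\<in>U. 1 * measure run_space (E u))"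
    using E(3) by (intro sum_mono) auto
  ultimately have "3 / 4 * real (card U) \<le> K" by simp
  also have "K = 3 / 8 * real (card U) + 2 / 3 * B ^ n"
    using Bn B(1) by (simp add: K_def \<kappa>_def field_simps)
  finally show ?thesis by simp
qed

text \<open>Answering as if \<open>u1\<close> were true has probability at most \<delta> under
  \<open>p0\<close> and at least \<open>1 - \<delta>\<close> under \<open>p1\<close>, which forces a
  divergence of order \<open>1 / \<delta>\<close>.\<close>

lemma two_hypotheses:
  assumes u: "2 * \<epsilon> < disagree d u0 u1"
    and p0: "\<And>x. 0 < p0 x \<and> p0 x < 1" and p1: "\<And>x. 0 \<le> p1 x \<and> p1 x \<le> 1"
    and B: "1 \<le> B" "\<And>x. (p1 x)\<^sup>2 / p0 x + (1 - p1 x)\<^sup>2 / (1 - p0 x) \<le> B"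
    and \<delta>: "0 < \<delta>" "\<delta> \<le> 1 / 4"
    and E0: "E0 \<in> sets run_space" "E0 \<subseteq> success_event d A p0 u0 \<epsilon> n" "1 - \<delta> \<le> measure run_space E0"
    and E1: "E1 \<in> sets run_space" "E1 \<subseteq> success_event d A p1 u1 \<epsilon> n" "1 - \<delta> \<le> measure run_space E1"
  shows "1 \<le> 2 * \<delta> * B ^ n"
proof -
  define K where "K = (2 * \<delta> * B ^ n + 1 / (2 * \<delta>)) / 2"
  \<comment> \<open>\<open>change_of_measure\<close> with \<open>\<kappa> = 2 * \<delta>\<close>
    gives the failure probability under \<open>p0\<close> the factor
    \<open>1 / (4 * \<delta>)\<close>; this becomes the weight of \<open>E0\<close> on the
    left.\<close>
  have "(\<Sum>b\<in>{False, True}. (if b then 1 else 1 / (4 * \<delta>)) * measure unif_seq (Pair r -` (if b then E1 else E0))) \<le> K" for r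
  proof -
    let ?S = "\<lambda>u. success_histories d (A r) u \<epsilon> n"
    have "measure unif_seq (Pair r -` E0) + sum (weight p0) (?S u1) \<le> sum (weight p0) (?S u0) + sum (weight p0) (?S u1)"
      using p0 by (intro add_right_mono measure_success_section_le E0) (auto simp: less_imp_le)
    also have "\<dots> = sum (weight p0) (?S u0 \<union> ?S u1)"
      using disjoint_success_histories[OF u]
      by (intro sum.union_disjoint[symmetric]) auto
    also have "\<dots> \<le> 1"
      using p0 by (intro sum_weight_le_1[of _ _ "A r" n]) (auto simp: success_histories_def)
    finally have 0: "sum (weight p0) (?S u1) \<le> 1 - measure unif_seq (Pair r -` E0)" by simp
    have "measure unif_seq (Pair r -` E1) \<le> sum (weight p1) (?S u1)"
      by (intro measure_success_section_le p1 E1)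
    also have "\<dots> \<le> (2 * \<delta> * B ^ n + sum (weight p0) (?S u1) / (2 * \<delta>)) / 2"
      using \<delta> by (intro change_of_measure[OF _ _ _ success_histories_subset] p0 B) auto
    also have "\<dots> \<le> (2 * \<delta> * B ^ n + (1 - measure unif_seq (Pair r -` E0)) / (2 * \<delta>)) / 2"
      using 0 \<delta> by (intro divide_right_mono add_left_mono) auto
    finally show ?thesis by (simp add: K_def diff_divide_distrib add_divide_distrib)
  qed
  then have "(\<Sum>b\<in>{False, True}. (if b then 1 else 1 / (4 * \<delta>)) * measure run_space (if b then E1 else E0)) \<le> K"
    using \<delta> E0(1) E1(1) by (intro sum_measure_run_space_le) auto
  then have "measure run_space E1 + measure run_space E0 / (4 * \<delta>) \<le> K"
    by (simp add: add.commute)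
  moreover have "(1 - \<delta>) / (4 * \<delta>) \<le> measure run_space E0 / (4 * \<delta>)"
    using E0(3) \<delta> by (intro divide_right_mono) auto
  ultimately have "1 - \<delta> + (1 - \<delta>) / (4 * \<delta>) \<le> K" using E1(3) by linarith
  then have "(1 - \<delta>) - 1 / 4 \<le> \<delta> * B ^ n"
    using \<delta> by (simp add: K_def diff_divide_distrib add_divide_distrib)
  then show ?thesis using \<delta> by simp
qed

text \<open>In the theorem the oracle is chosen before \<open>n\<close>. Success is monotone in the number of queries
  as a set, but possibly not measurable at the largest budget, where \<open>measure\<close> would then be zero;
  so the events at the individual budgets, measurable because their measure is positive, are kept.\<close>

lemma common_query_budget:
  assumes V: "finite V" "V \<noteq> {}" and \<delta>: "\<delta> < 1"
    and n: "\<And>u. u \<in> V \<Longrightarrow> \<exists>n. 1 - \<delta> \<le> measure run_space (success_event d A (p u) u \<epsilon> n) \<and> real n < b"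
  shows "\<exists>N E. real N < b \<and> (\<forall>u\<in>V. E u \<in> sets run_space \<and>
    E u \<subseteq> success_event d A (p u) u \<epsilon> N \<and> 1 - \<delta> \<le> measure run_space (E u))"
proof -
  obtain m where m: "\<And>u. u \<in> V \<Longrightarrow> 1 - \<delta> \<le> measure run_space (success_event d A (p u) u \<epsilon> (m u))"
      "\<And>u. u \<in> V \<Longrightarrow> real (m u) < b"
    using n by metis
  define N where "N = Max (m ` V)"
  have "N \<in> m ` V" unfolding N_def using V by (intro Max_in) auto
  then have "real N < b" using m(2) by auto
  moreover have "success_event d A (p u) u \<epsilon> (m u) \<in> sets run_space" if "u \<in> V" for u
    using m(1)[OF that] \<delta> measure_notin_sets[of "success_event d A (p u) u \<epsilon> (m u)" run_space]
    by (cases "success_event d A (p u) u \<epsilon> (m u) \<in> sets run_space") auto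
  moreover have "success_event d A (p u) u \<epsilon> (m u) \<subseteq> success_event d A (p u) u \<epsilon> N" if "u \<in> V" for u
    using that V by (intro success_event_mono) (auto simp: N_def)
  ultimately show ?thesis
    using m(1) by (intro exI[of _ N] exI[of _ "\<lambda>u. success_event d A (p u) u \<epsilon> (m u)"]) auto
qed

text \<open>Noise at the full rate \<eta> everywhere: a label reveals nothing about the distance of
  the point to the hyperplane.\<close>

definition flip_oracle :: "nat \<Rightarrow> real \<Rightarrow> (nat \<Rightarrow> real) \<Rightarrow> (nat \<Rightarrow> real) \<Rightarrow> real" where
  "flip_oracle d \<eta> u x = (if sgnp (dotd d u x) = 1 then 1 - \<eta> else \<eta>)"

lemma bounded_noise_flip_oracle:
  assumes "0 \<le> \<eta>" "\<eta> < 1 / 2"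
  shows "bounded_noise_oracle d \<eta> u (flip_oracle d \<eta> u)"
proof -
  have "(\<lambda>x::nat \<Rightarrow> real. x i) \<in> borel_measurable borel" for i
    by (intro borel_measurable_continuous_onI continuous_on_product_coordinates)
  then have "dotd d u \<in> borel_measurable borel"
    unfolding dotd_def by measurable
  then have "flip_oracle d \<eta> u \<in> borel_measurable borel"
    unfolding flip_oracle_def by measurable
  with assms show ?thesis
    by (auto simp: bounded_noise_oracle_def flip_oracle_def)
qed

text \<open>If the claim failed, every \<open>u\<close> in \<open>U\<close> would have a budget
  below the bound; at a common budget \<open>many_hypotheses\<close> and
  \<open>ln (1 + x) \<le> x\<close> contradict this.\<close>

lemma packing_query_bound:
  assumes U: "finite U" "2 \<le> card U" "\<And>u u'. u \<in> U \<Longrightarrow> u' \<in> U \<Longrightarrow> u \<noteq> u' \<Longrightarrow> 2 * \<epsilon> < disagree d u u'"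
    and \<eta>: "0 \<le> \<eta>" "\<eta> < 1 / 2" and \<delta>: "\<delta> \<le> 1 / 4"
  shows "\<exists>u\<in>U. \<forall>n. 1 - \<delta> \<le> measure run_space (success_event d A (flip_oracle d \<eta> u) u \<epsilon> n) \<longrightarrow>
    ln (real (card U)) / (8 * (1 - 2 * \<eta>)\<^sup>2) \<le> real n"
proof (rule ccontr)
  assume neg: "\<not> ?thesis"
  have \<theta>: "0 < (1 - 2 * \<eta>)\<^sup>2" using \<eta> by simp
  define M where "M = real (card U)"
  have M: "2 \<le> M" using U(2) by (simp add: M_def)
  have "U \<noteq> {}" using U(2) by auto
  then have "\<exists>N E. real N < ln (real (card U)) / (8 * (1 - 2 * \<eta>)\<^sup>2) \<and> (\<forall>u\<in>U. E u \<in> sets run_space \<and>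
    E u \<subseteq> success_event d A (flip_oracle d \<eta> u) u \<epsilon> N \<and> 1 - \<delta> \<le> measure run_space (E u))"
    using U(1) neg \<delta> by (intro common_query_budget) (auto simp: not_le)
  then obtain N E where NE: "real N < ln (real (card U)) / (8 * (1 - 2 * \<eta>)\<^sup>2)"
      "\<And>u. u \<in> U \<Longrightarrow> E u \<in> sets run_space"
      "\<And>u. u \<in> U \<Longrightarrow> E u \<subseteq> success_event d A (flip_oracle d \<eta> u) u \<epsilon> N"
      "\<And>u. u \<in> U \<Longrightarrow> 1 - \<delta> \<le> measure run_space (E u)"
    by blast
  have "9 / 16 * M \<le> (1 + (1 - 2 * \<eta>)\<^sup>2) ^ N"
    unfolding M_def
  proof (rule many_hypotheses[OF U(1,3) _ _ _ NE(2,3)])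
    show "0 \<le> flip_oracle d \<eta> u x \<and> flip_oracle d \<eta> u x \<le> 1" for u x
      using \<eta> by (simp add: flip_oracle_def)
    show "2 * (flip_oracle d \<eta> u x)\<^sup>2 + 2 * (1 - flip_oracle d \<eta> u x)\<^sup>2 \<le> 1 + (1 - 2 * \<eta>)\<^sup>2" for u x
      by (simp add: flip_oracle_def power2_eq_square algebra_simps)
    show "3 / 4 \<le> measure run_space (E u)" if "u \<in> U" for u
      using NE(4)[OF that] \<delta> by simp
  qed auto
  then have "ln (9 / 16 * M) \<le> N * ln (1 + (1 - 2 * \<eta>)\<^sup>2)"
    using M \<theta> by (subst ln_realpow[symmetric]) (auto intro!: add_pos_pos)
  also have "\<dots> \<le> N * (1 - 2 * \<eta>)\<^sup>2"
    using \<theta> by (intro mult_left_mono ln_add_one_self_le_self) auto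
  also have "\<dots> < ln M / 8"
    using NE(1) \<theta> by (simp add: M_def field_simps)
  \<comment> \<open>The eighth power absorbs the factor \<open>9/16\<close> even in the tightest
    case \<open>M = 2\<close>: \<open>128 * (9/16) ^ 8\<close> still exceeds 1.\<close>
  finally have "ln ((9 / 16 * M) ^ 8) < ln M"
    using M by (simp add: ln_realpow)
  then have "(9 / 16 * M) ^ 8 < M" using M by simp
  moreover have "M * 2 ^ 7 \<le> M * M ^ 7" using M by (intro mult_left_mono power_mono) auto
  then have "M * 128 \<le> M ^ 8" by (simp add: power_eq_if)
  ultimately show False using M by (simp add: power_mult_distrib power_divide)
qed

lemma pair_query_bound:
  assumes u: "2 * \<epsilon> < disagree d u0 u1"
    and \<eta>: "0 < \<eta>" "\<eta> < 1 / 2" and \<delta>: "0 < \<delta>" "\<delta> \<le> 1 / 4"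
  shows "\<exists>u\<in>{u0, u1}. \<forall>n. 1 - \<delta> \<le> measure run_space (success_event d A (flip_oracle d \<eta> u) u \<epsilon> n) \<longrightarrow>
    \<eta> * ln (1 / \<delta>) / (4 * (1 - 2 * \<eta>)\<^sup>2) \<le> real n"
proof (rule ccontr)
  assume neg: "\<not> ?thesis"
  have \<theta>: "0 < (1 - 2 * \<eta>)\<^sup>2" using \<eta> by simp
  define B where "B = 1 + (1 - 2 * \<eta>)\<^sup>2 / (\<eta> * (1 - \<eta>))"
  have B1: "1 \<le> B" using \<eta> by (simp add: B_def)
  define V where "V = {u0, u1}"
  have "\<exists>N E. real N < \<eta> * ln (1 / \<delta>) / (4 * (1 - 2 * \<eta>)\<^sup>2) \<and> (\<forall>u\<in>V. E u \<in> sets run_space \<and>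
    E u \<subseteq> success_event d A (flip_oracle d \<eta> u) u \<epsilon> N \<and> 1 - \<delta> \<le> measure run_space (E u))"
    using neg \<delta> unfolding V_def by (intro common_query_budget) (auto simp: not_le)
  then obtain N E where N: "real N < \<eta> * ln (1 / \<delta>) / (4 * (1 - 2 * \<eta>)\<^sup>2)"
    and E: "\<And>u. u \<in> V \<Longrightarrow> E u \<in> sets run_space"
      "\<And>u. u \<in> V \<Longrightarrow> E u \<subseteq> success_event d A (flip_oracle d \<eta> u) u \<epsilon> N"
      "\<And>u. u \<in> V \<Longrightarrow> 1 - \<delta> \<le> measure run_space (E u)"
    by blast
  have V: "u0 \<in> V" "u1 \<in> V" by (simp_all add: V_def)
  have "1 \<le> 2 * \<delta> * B ^ N"
  proof (rule two_hypotheses[OF u _ _ B1 _ \<delta> E(1-3)[OF V(1)] E(1-3)[OF V(2)]])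
    show "(flip_oracle d \<eta> u1 x)\<^sup>2 / flip_oracle d \<eta> u0 x
        + (1 - flip_oracle d \<eta> u1 x)\<^sup>2 / (1 - flip_oracle d \<eta> u0 x) \<le> B" for x
    proof -
      \<comment> \<open>The value where the two oracles favour opposite labels; where they agree the
        sum is 1, and a query there gives no information.\<close>
      have "(1 - \<eta>)\<^sup>2 / \<eta> + \<eta>\<^sup>2 / (1 - \<eta>) = B"
        using \<eta> by (simp add: B_def field_simps power2_eq_square)
      moreover have "\<eta>\<^sup>2 / \<eta> + (1 - \<eta>)\<^sup>2 / (1 - \<eta>) = 1"
        using \<eta> by (simp add: power2_eq_square)
      ultimately show ?thesis using B1 by (auto simp: flip_oracle_def)
    qed
  qed (use \<eta> in \<open>auto simp: flip_oracle_def\<close>)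
  then have "ln (1 / (2 * \<delta>)) \<le> ln (B ^ N)"
    using \<delta> B1 by (subst ln_le_cancel_iff) (auto simp: field_simps)
  also have "\<dots> = N * ln B" using B1 by (simp add: ln_realpow)
  also have "\<dots> \<le> N * ((1 - 2 * \<eta>)\<^sup>2 / (\<eta> * (1 - \<eta>)))"
    unfolding B_def using \<eta> by (intro mult_left_mono ln_add_one_self_le_self) auto
  also have "\<dots> \<le> N * ((1 - 2 * \<eta>)\<^sup>2 / (\<eta> * (1 / 2)))"
    using \<eta> by (intro mult_left_mono divide_left_mono) auto
  also have "\<dots> < ln (1 / \<delta>) / 2"
    using N \<theta> \<eta> by (simp add: field_simps)
  finally have "2 * ln (1 / (2 * \<delta>)) < ln (1 / \<delta>)" by simp
  \<comment> \<open>Since \<open>\<delta> \<le> 1/4\<close>, half of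
    \<open>ln (1 / \<delta>)\<close> covers the factor 2 in \<open>2 * \<delta>\<close>.\<close>
  moreover have "2 * ln (1 / (2 * \<delta>)) = ln (1 / \<delta>) + ln (1 / (4 * \<delta>))"
    using \<delta> by (simp add: ln_div ln_mult flip: ln_realpow[of 2 2, simplified])
  moreover have "0 \<le> ln (1 / (4 * \<delta>))" using \<delta> by (intro ln_ge_zero) auto
  ultimately show False by simp
qed

subsection \<open>Codes in the Hamming cube\<close>

lemma power_swap: "(x ^ m) ^ n = (x ^ n) ^ m" for x :: "'a :: monoid_mult"
  by (simp add: mult.commute flip: power_mult)

definition hamming :: "nat \<Rightarrow> (nat \<Rightarrow> nat) \<Rightarrow> (nat \<Rightarrow> nat) \<Rightarrow> nat" where
  "hamming m w w' = card {i \<in> {..<m}. w i \<noteq> w' i}"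

definition words :: "nat \<Rightarrow> nat \<Rightarrow> (nat \<Rightarrow> nat) set" where
  "words m K = (\<Pi>\<^sub>E i\<in>{..<m}. {..<K})"

lemma finite_words [simp]: "finite (words m K)"
  by (simp add: words_def finite_PiE)

lemma card_words: "card (words m K) = K ^ m"
  by (simp add: words_def card_PiE)

lemma hamming_commute: "hamming m w w' = hamming m w' w"
  by (simp add: hamming_def eq_commute)

text \<open>The distance enumerator factors over the coordinates: in each of them one letter agrees
  with \<open>w\<close> and \<open>K - 1\<close> differ.\<close>

lemma sum_power_hamming:
  fixes c :: real
  assumes w: "w \<in> words m K"
  shows "(\<Sum>w'\<in>words m K. c ^ hamming m w w') = (1 + (real K - 1) * c) ^ m"
proof -
  have *: "c ^ hamming m w w' = (\<Prod>i<m. if w i \<noteq> w' i then c else 1)" for w'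
    by (simp add: hamming_def prod.If_cases Int_def)
  have "(\<Sum>w'\<in>words m K. c ^ hamming m w w') = (\<Prod>i<m. \<Sum>j<K. if w i \<noteq> j then c else 1)"
    unfolding * words_def by (rule prod_sum_PiE[symmetric]) auto
  also have "\<dots> = (\<Prod>i<m. 1 + (real K - 1) * c)"
  proof (intro prod.cong refl)
    fix i assume "i \<in> {..<m}"
    then have i: "w i \<in> {..<K}" using w by (auto simp: words_def)
    then have "(\<Sum>j<K. if w i \<noteq> j then c else 1) = 1 + (\<Sum>j\<in>{..<K} - {w i}. if w i \<noteq> j then c else 1)"
      by (subst sum.remove[OF _ i]) auto
    also have "(\<Sum>j\<in>{..<K} - {w i}. if w i \<noteq> j then c else 1) = (\<Sum>j\<in>{..<K} - {w i}. c)"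
      by (intro sum.cong) auto
    also have "\<dots> = (real K - 1) * c" using i by (simp add: of_nat_diff)
    finally show "(\<Sum>j<K. if w i \<noteq> j then c else 1) = 1 + (real K - 1) * c" .
  qed
  finally show ?thesis by simp
qed

text \<open>Chernoff: weigh a word at distance \<open>h\<close> by \<open>\<lambda> ^ h\<close> with \<open>\<lambda> = 1 / (3 (K - 1))\<close>.\<close>

lemma card_hamming_ball:
  assumes K: "2 \<le> K" and w: "w \<in> words m K"
  shows "real (card {w' \<in> words m K. 4 * hamming m w w' < m}) ^ 4 * 27 ^ m \<le> (256 * (real K - 1)) ^ m"
proof -
  define l where "l = 1 / (3 * (real K - 1))"
  have l: "0 < l" "l \<le> 1" using K by (auto simp: l_def field_simps)
  have Kl: "(real K - 1) * l = 1 / 3" using K by (simp add: l_def field_simps)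
  \<comment> \<open>This is \<open>l\<close> to the power \<open>m / 4\<close>, the least weight
    inside the ball; the root is used because \<open>m / 4\<close> need not be an integer.\<close>
  define b where "b = root 4 (l ^ m)"
  have b: "0 \<le> b" "b ^ 4 = l ^ m" using l by (simp_all add: b_def)
  let ?B = "{w' \<in> words m K. 4 * hamming m w w' < m}"
  have "real (card ?B) * b = (\<Sum>w'\<in>?B. b)" by simp
  also have "\<dots> \<le> (\<Sum>w'\<in>?B. l ^ hamming m w w')"
  proof (rule sum_mono)
    fix w' assume "w' \<in> ?B"
    then have "l ^ m \<le> l ^ (hamming m w w' * 4)" using l by (intro power_decreasing) auto
    then have "b ^ 4 \<le> (l ^ hamming m w w') ^ 4" by (simp add: b power_mult)
    then show "b \<le> l ^ hamming m w w'" using l by (intro power_le_imp_le_base[of b 3]) auto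
  qed
  also have "\<dots> \<le> (\<Sum>w'\<in>words m K. l ^ hamming m w w')"
    using l by (intro sum_mono2) auto
  also have "\<dots> = (4 / 3) ^ m"
    unfolding sum_power_hamming[OF w] Kl by simp
  finally have "(real (card ?B) * b) ^ 4 \<le> ((4 / 3) ^ m) ^ 4"
    using b by (intro power_mono) auto
  then have "real (card ?B) ^ 4 * l ^ m \<le> ((4 / 3) ^ 4) ^ m"
    by (simp only: power_mult_distrib b power_swap[of _ m 4])
  \<comment> \<open>The factor clears denominators: \<open>81 * (K - 1) * l = 27\<close> and
    \<open>81 * (4/3) ^ 4 = 256\<close>.\<close>
  then have "real (card ?B) ^ 4 * l ^ m * (81 * (real K - 1)) ^ m \<le> ((4 / 3) ^ 4) ^ m * (81 * (real K - 1)) ^ m"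
    using K by (intro mult_right_mono) auto
  also have "\<dots> = (256 * (real K - 1)) ^ m"
  proof -
    have "(4 / 3) ^ 4 * (81 * (real K - 1)) = 256 * (real K - 1)" by (simp add: power_divide)
    then show ?thesis by (simp only: power_mult_distrib[symmetric])
  qed
  also have "real (card ?B) ^ 4 * l ^ m * (81 * (real K - 1)) ^ m = real (card ?B) ^ 4 * 27 ^ m"
  proof -
    have "l ^ m * (81 * (real K - 1)) ^ m = (81 * ((real K - 1) * l)) ^ m"
      unfolding power_mult_distrib[symmetric] by (simp add: mult_ac)
    then show ?thesis by (simp add: Kl mult.assoc)
  qed
  finally show ?thesis .
qed

text \<open>Gilbert-Varshamov: the balls of radius \<open>m / 4\<close> around a maximal code cover
  all words, so the code has at least \<open>K ^ m\<close> divided by the ball bound many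
  members.\<close>

lemma exists_code:
  assumes K: "2 \<le> K" and m: "0 < m"
  shows "\<exists>C \<subseteq> words m K. (\<forall>w\<in>C. \<forall>w'\<in>C. w \<noteq> w' \<longrightarrow> m \<le> 4 * hamming m w w') \<and> real K ^ m \<le> real (card C) ^ 8"
proof -
  define codes where "codes = {C. C \<subseteq> words m K \<and> (\<forall>w\<in>C. \<forall>w'\<in>C. w \<noteq> w' \<longrightarrow> m \<le> 4 * hamming m w w')}"
  have "finite codes" unfolding codes_def by (rule finite_subset[of _ "Pow (words m K)"]) auto
  moreover have "{} \<in> codes" by (simp add: codes_def)
  ultimately obtain C where C: "C \<in> codes" and max: "\<And>C'. C' \<in> codes \<Longrightarrow> C \<subseteq> C' \<Longrightarrow> C = C'"
    using finite_has_maximal[of codes] by blast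
  have fin: "finite C" using C by (auto simp: codes_def intro: finite_subset)
  define ball where "ball w = {w' \<in> words m K. 4 * hamming m w w' < m}" for w
  have "words m K \<subseteq> (\<Union>w\<in>C. ball w)"
  proof
    fix w assume w: "w \<in> words m K"
    show "w \<in> (\<Union>w\<in>C. ball w)"
    proof (rule ccontr)
      assume "w \<notin> (\<Union>w\<in>C. ball w)"
      then have far: "m \<le> 4 * hamming m w' w" if "w' \<in> C" for w'
        using that w by (auto simp: ball_def not_less)
      moreover have "m \<le> 4 * hamming m w w'" if "w' \<in> C" for w'
        using far[OF that] by (simp only: hamming_commute[of m w])
      ultimately have "insert w C \<in> codes"
        using C w by (auto simp: codes_def)
      then have "w \<in> C" using max by blast
      \<comment> \<open>A word of the code would lie in its own ball, at distance 0.\<close>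
      then show False using far[of w] m by (simp add: hamming_def)
    qed
  qed
  then have "K ^ m \<le> card (\<Union>w\<in>C. ball w)"
    unfolding card_words[symmetric] by (intro card_mono) (auto simp: fin ball_def)
  also have "\<dots> \<le> (\<Sum>w\<in>C. card (ball w))" by (rule card_UN_le[OF fin])
  finally have "real (K ^ m) \<le> real (\<Sum>w\<in>C. card (ball w))" by (rule of_nat_mono)
  also have "\<dots> = (\<Sum>w\<in>C. real (card (ball w)))" by simp
  finally have cover: "real K ^ m \<le> (\<Sum>w\<in>C. real (card (ball w)))" by simp
  define V where "V = root 4 ((256 * (real K - 1) / 27) ^ m)"
  have V: "0 < V" "V ^ 4 = (256 * (real K - 1) / 27) ^ m" using K by (simp_all add: V_def)
  have "real (card (ball w)) \<le> V" if "w \<in> C" for w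
  proof -
    have "real (card (ball w)) ^ 4 \<le> V ^ 4"
    proof -
      have "w \<in> words m K" using that C unfolding codes_def by blast
      from card_hamming_ball[OF K this] show ?thesis
        unfolding V power_divide ball_def by (simp add: pos_le_divide_eq)
    qed
    then show ?thesis
      using power_mono_iff[of "real (card (ball w))" V 4] V(1) by simp
  qed
  then have "(\<Sum>w\<in>C. real (card (ball w))) \<le> (\<Sum>w\<in>C. V)" by (rule sum_mono)
  with cover have "real K ^ m \<le> real (card C) * V" by (simp only: sum_constant)
  then have "(real K ^ m) ^ 8 \<le> (real (card C) * V) ^ 8" by (intro power_mono) auto
  also have "\<dots> = real (card C) ^ 8 * (V ^ 4)\<^sup>2"
    using power_mult[of V 4 2] by (simp add: power_mult_distrib)
  also have "\<dots> = real (card C) ^ 8 * ((256 * (real K - 1) / 27)\<^sup>2) ^ m"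
    by (simp only: V power_swap[of _ m 2])
  also have "(real K ^ m) ^ 8 = (real K ^ 8) ^ m" by (rule power_swap)
  finally have le: "(real K ^ 8) ^ m \<le> real (card C) ^ 8 * ((256 * (real K - 1) / 27)\<^sup>2) ^ m" .
  \<comment> \<open>The claim reduces to one coordinate: the square of \<open>256/27\<close> is
    below 90, hence below both \<open>2 ^ 7\<close>, settling \<open>K = 2\<close>, and
    \<open>3 ^ 5\<close>, settling \<open>K \<ge> 3\<close>.\<close>
  have "(256 * (real K - 1) / 27)\<^sup>2 * real K \<le> real K ^ 8"
  proof -
    have "(256 * (real K - 1) / 27)\<^sup>2 \<le> real K ^ 7"
    proof (cases "K = 2")
      case True then show ?thesis by (simp add: power2_eq_square)
    next
      case False
      then have "3 \<le> real K" using K by simp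
      then have "3 ^ 5 * (real K)\<^sup>2 \<le> real K ^ 5 * (real K)\<^sup>2" by (intro mult_right_mono power_mono) auto
      moreover have "(256 * (real K - 1) / 27)\<^sup>2 \<le> (256 * real K / 27)\<^sup>2"
        using K by (intro power_mono divide_right_mono) auto
      moreover have "real K ^ 5 * (real K)\<^sup>2 = real K ^ 7" by (simp flip: power_add)
      moreover have "(256 * real K / 27)\<^sup>2 \<le> 3 ^ 5 * (real K)\<^sup>2"
        unfolding power_divide power_mult_distrib by simp
      ultimately show ?thesis by linarith
    qed
    then have "(256 * (real K - 1) / 27)\<^sup>2 * real K \<le> real K ^ 7 * real K"
      by (intro mult_right_mono) auto
    then show ?thesis by (simp flip: power_Suc2)
  qed
  then have "((256 * (real K - 1) / 27)\<^sup>2) ^ m * real K ^ m \<le> (real K ^ 8) ^ m"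
    unfolding power_mult_distrib[symmetric] using K by (intro power_mono) auto
  with le have "((256 * (real K - 1) / 27)\<^sup>2) ^ m * real K ^ m \<le> ((256 * (real K - 1) / 27)\<^sup>2) ^ m * real (card C) ^ 8"
    by (simp add: mult.commute)
  moreover have "0 < ((256 * (real K - 1) / 27)\<^sup>2) ^ m" using K by simp
  ultimately have "real K ^ m \<le> real (card C) ^ 8" by (simp only: mult_le_cancel_left_pos)
  with C show ?thesis by (auto simp: codes_def)
qed

subsection \<open>Disagreement of Gaussian half-spaces\<close>

abbreviation gauss_on :: "nat set \<Rightarrow> (nat \<Rightarrow> real) measure" where
  "gauss_on I \<equiv> PiM I (\<lambda>_. density lborel std_normal_density)"

lemma prob_space_std_normal: "prob_space (density lborel std_normal_density)"
  by (rule prob_space_normal_density) simp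

lemma prob_space_gauss_on: "prob_space (gauss_on I)"
  by (intro prob_space_PiM prob_space_std_normal)

lemma indep_vars_gauss_on:
  assumes J: "J \<subseteq> I" "J \<noteq> {}"
  shows "prob_space.indep_vars (gauss_on I) (\<lambda>_. borel) (\<lambda>i g. g i) J"
proof -
  interpret prob_space "gauss_on I" by (rule prob_space_gauss_on)
  have rv: "random_variable borel (\<lambda>g. g i)" if "i \<in> J" for i
  proof -
    have "i \<in> I" using that J by blast
    then show ?thesis by measurable
  qed
  have comp: "distr (gauss_on I) borel (\<lambda>g. g i) = density lborel std_normal_density" if "i \<in> J" for i
  proof -
    have "distr (gauss_on I) borel (\<lambda>g. g i) = distr (gauss_on I) (density lborel std_normal_density) (\<lambda>g. g i)"
      by (intro distr_cong) auto
    also have "\<dots> = density lborel std_normal_density"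
      using that J by (intro distr_PiM_component prob_space_std_normal) auto
    finally show ?thesis .
  qed
  have "distr (gauss_on I) (PiM J (\<lambda>_. borel)) (\<lambda>g. \<lambda>i\<in>J. g i) = distr (gauss_on I) (gauss_on J) (\<lambda>g. \<lambda>i\<in>J. g i)"
    by (intro distr_cong sets_PiM_cong) auto
  also have "\<dots> = gauss_on J"
    using J distr_PiM_reindex[of I "\<lambda>_. density lborel std_normal_density" "\<lambda>i. i" J] prob_space_std_normal
    by auto
  also have "\<dots> = PiM J (\<lambda>i. distr (gauss_on I) borel (\<lambda>g. g i))"
    by (intro PiM_cong) (simp_all add: comp)
  finally show ?thesis
    using J rv by (subst indep_vars_iff_distr_eq_PiM') auto
qed

lemma linear_form_normal:
  assumes I: "finite I" and t: "(\<Sum>i\<in>I. (t i)\<^sup>2) \<noteq> 0"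
  shows "distributed (gauss_on I) lborel (\<lambda>g. \<Sum>i\<in>I. t i * g i)
    (normal_density 0 (sqrt (\<Sum>i\<in>I. (t i)\<^sup>2)))"
proof -
  interpret prob_space "gauss_on I" by (rule prob_space_gauss_on)
  \<comment> \<open>Terms with coefficient zero are dropped: they have variance zero and hence no
    normal density.\<close>
  define J where "J = {i \<in> I. t i \<noteq> 0}"
  have J: "finite J" "J \<subseteq> I" using I by (auto simp: J_def)
  have "J \<noteq> {}" using t I by (auto simp: J_def sum_nonneg_eq_0_iff)
  have "distributed (gauss_on I) lborel (\<lambda>g. g i) std_normal_density" if "i \<in> J" for i
  proof -
    have "distr (gauss_on I) lborel (\<lambda>g. g i) = distr (gauss_on I) (density lborel std_normal_density) (\<lambda>g. g i)"
      by (intro distr_cong) auto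
    also have "\<dots> = density lborel std_normal_density"
      using that J by (intro distr_PiM_component prob_space_std_normal) auto
    finally show ?thesis
      using that J by (auto simp: distributed_def)
  qed
  then have "distributed (gauss_on I) lborel (\<lambda>g. t i * g i) (normal_density 0 \<bar>t i\<bar>)" if "i \<in> J" for i
    using normal_density_affine[of "\<lambda>g. g i" 0 1 "t i" 0] that by (auto simp: J_def)
  moreover have "indep_vars (\<lambda>_. borel) (\<lambda>i g. t i * g i) J"
    by (rule indep_vars_compose2[OF indep_vars_gauss_on[OF J(2) \<open>J \<noteq> {}\<close>]]) simp
  ultimately have "distributed (gauss_on I) lborel (\<lambda>g. \<Sum>i\<in>J. t i * g i)
      (normal_density (\<Sum>i\<in>J. 0) (sqrt (\<Sum>i\<in>J. \<bar>t i\<bar>\<^sup>2)))"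
    using J \<open>J \<noteq> {}\<close> by (intro sum_indep_normal) (auto simp: J_def)
  moreover have "(\<Sum>i\<in>J. t i * g i) = (\<Sum>i\<in>I. t i * g i)" for g
    using I J by (intro sum.mono_neutral_left) (auto simp: J_def)
  moreover have "(\<Sum>i\<in>J. \<bar>t i\<bar>\<^sup>2) = (\<Sum>i\<in>I. (t i)\<^sup>2)"
    unfolding power2_abs using I J by (intro sum.mono_neutral_left) (auto simp: J_def)
  ultimately show ?thesis by simp
qed

lemma linear_form_moments:
  fixes t :: "nat \<Rightarrow> real"
  assumes I: "finite I"
  defines "L \<equiv> \<lambda>g. \<Sum>i\<in>I. t i * g i"
  shows "has_bochner_integral (gauss_on I) (\<lambda>g. \<bar>L g\<bar>) (sqrt (2 / pi) * sqrt (\<Sum>i\<in>I. (t i)\<^sup>2))"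
    and "has_bochner_integral (gauss_on I) (\<lambda>g. (L g)\<^sup>2) (\<Sum>i\<in>I. (t i)\<^sup>2)"
    and "has_bochner_integral (gauss_on I) (\<lambda>g. (L g) ^ 4) (3 * (\<Sum>i\<in>I. (t i)\<^sup>2)\<^sup>2)"
proof -
  define s where "s = (\<Sum>i\<in>I. (t i)\<^sup>2)"
  have "has_bochner_integral (gauss_on I) (\<lambda>g. \<bar>L g\<bar>) (sqrt (2 / pi) * sqrt s) \<and>
    has_bochner_integral (gauss_on I) (\<lambda>g. (L g)\<^sup>2) s \<and>
    has_bochner_integral (gauss_on I) (\<lambda>g. (L g) ^ 4) (3 * s\<^sup>2)"
  \<comment> \<open>The zero form has no density but satisfies the same formulas; it can occur later
    as the sum of opposite vectors.\<close>
  proof (cases "s = 0")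
    case True
    then have "t i = 0" if "i \<in> I" for i
      using that I by (auto simp: s_def sum_nonneg_eq_0_iff)
    then have "L g = 0" for g by (simp add: L_def)
    then show ?thesis using True by (simp add: has_bochner_integral_zero)
  next
    case False
    then have D: "distributed (gauss_on I) lborel L (normal_density 0 (sqrt s))"
      unfolding L_def s_def using linear_form_normal[OF I] by blast
    have s: "0 < s" using False by (simp add: s_def order.not_eq_order_implies_strict sum_nonneg)
    have tr: "has_bochner_integral (gauss_on I) (\<lambda>g. f (L g)) x"
      if "has_bochner_integral lborel (\<lambda>z. normal_density 0 (sqrt s) z * f z) x"
        and [measurable]: "f \<in> borel_measurable borel" for f :: "real \<Rightarrow> real" and x
      using that distributed_integrable[OF D, of f] distributed_integral[OF D, of f]
      by (simp add: has_bochner_integral_iff normal_density_nonneg)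
    have "has_bochner_integral (gauss_on I) (\<lambda>g. \<bar>L g\<bar>) (sqrt (2 / pi) * sqrt s)"
      using normal_moment_abs_odd[of "sqrt s" 0 0] s
      by (intro tr[of abs]) (simp_all add: mult.commute)
    moreover have "has_bochner_integral (gauss_on I) (\<lambda>g. (L g)\<^sup>2) s"
      using normal_moment_even[of "sqrt s" 0 1] s
      by (intro tr[of "\<lambda>z. z\<^sup>2"]) (simp_all add: fact_numeral)
    moreover have "has_bochner_integral (gauss_on I) (\<lambda>g. (L g) ^ 4) (3 * s\<^sup>2)"
      using normal_moment_even[of "sqrt s" 0 2] s
      by (intro tr[of "\<lambda>z. z ^ 4"]) (simp_all add: fact_numeral power2_eq_square mult_ac)
    ultimately show ?thesis by blast
  qed
  then show "has_bochner_integral (gauss_on I) (\<lambda>g. \<bar>L g\<bar>) (sqrt (2 / pi) * sqrt (\<Sum>i\<in>I. (t i)\<^sup>2))"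
    and "has_bochner_integral (gauss_on I) (\<lambda>g. (L g)\<^sup>2) (\<Sum>i\<in>I. (t i)\<^sup>2)"
    and "has_bochner_integral (gauss_on I) (\<lambda>g. (L g) ^ 4) (3 * (\<Sum>i\<in>I. (t i)\<^sup>2)\<^sup>2)"
    by (simp_all add: s_def)
qed

text \<open>Integrates \<open>exp (- x\<^sup>2 / 2) \<ge> 1 - x\<^sup>2 / 2\<close>. The interval is
  half-open because \<open>sgnp\<close> counts zero as positive.\<close>

lemma std_normal_interval_ge:
  assumes "a \<le> b"
  shows "((b - a) - (b ^ 3 - a ^ 3) / 6) / sqrt (2 * pi)
    \<le> measure (density lborel std_normal_density) {a..<b}"
proof -
  interpret prob_space "density lborel std_normal_density" by (rule prob_space_std_normal)
  define F where "F x = (x - x ^ 3 / 6) / sqrt (2 * pi)" for x :: real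
  define f where "f x = (1 - x\<^sup>2 / 2) / sqrt (2 * pi)" for x :: real
  have "has_bochner_integral lborel (\<lambda>x. f x * indicator {a..b} x) (F b - F a)"
  proof (rule has_bochner_integral_FTC_Icc_real[OF assms])
    show "DERIV F x :> f x" for x
      unfolding F_def f_def by (auto intro!: derivative_eq_intros simp: field_simps)
    show "isCont f x" for x
      unfolding f_def by (intro continuous_intros) auto
  qed
  then have int: "integrable lborel (\<lambda>x. f x * indicator {a..b} x)"
    and eq: "(\<integral>x. f x * indicator {a..b} x \<partial>lborel) = F b - F a"
    by (auto simp: has_bochner_integral_iff)
  have le: "f x \<le> std_normal_density x" for x
  proof -
    have "f x \<le> exp (- x\<^sup>2 / 2) / sqrt (2 * pi)"
      unfolding f_def using exp_ge_add_one_self[of "- x\<^sup>2 / 2"] by (intro divide_right_mono) auto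
    then show ?thesis by (simp add: std_normal_density_def)
  qed
  have "(F b - F a) \<le> (\<integral>x. std_normal_density x * indicator {a..b} x \<partial>lborel)"
    unfolding eq[symmetric]
  proof (rule integral_mono[OF int])
    show "integrable lborel (\<lambda>x. std_normal_density x * indicator {a..b} x)"
      by (rule integrable_real_mult_indicator) auto
    show "f x * indicator {a..b} x \<le> std_normal_density x * indicator {a..b} x" for x
      using le by (simp add: indicator_def)
  qed
  also have "\<dots> = (\<integral>x. indicator {a..b} x \<partial>density lborel std_normal_density)"
    by (subst integral_real_density) (auto simp: normal_density_nonneg)
  also have "\<dots> = prob {a..b}" by simp
  also have "\<dots> = prob ({a..<b} \<union> {b})"
    using assms by (intro arg_cong[of _ _ prob]) auto
  also have "\<dots> \<le> prob {a..<b} + prob {b}"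
    by (intro measure_Un_le) auto
  also have "prob {b} = 0"
    by (simp add: measure_def emeasure_density nn_integral_indicator_singleton')
  finally show ?thesis by (simp add: F_def diff_divide_distrib)
qed

section \<open>Directions \<open>(1, t)\<close> and reduction to Gaussian vectors\<close>

definition lift :: "nat \<Rightarrow> (nat \<Rightarrow> real) \<Rightarrow> nat \<Rightarrow> real" where
  "lift d t i = (if d \<le> i then 0 else (if i = 0 then 1 else t i) / sqrt (1 + (\<Sum>i\<in>{1..<d}. (t i)\<^sup>2)))"

lemma lessThan_eq_insert_0: "0 < d \<Longrightarrow> {..<d} = insert 0 {1..<d}" for d :: nat
  by auto

lemma lift_in_sphere:
  assumes "0 < d"
  shows "lift d t \<in> sphere_d d"
proof -
  define a where "a = 1 + (\<Sum>i\<in>{1..<d}. (t i)\<^sup>2)"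
  have a: "1 \<le> a" by (simp add: a_def sum_nonneg)
  have "(\<Sum>i<d. (lift d t i)\<^sup>2) = (1 / sqrt a)\<^sup>2 + (\<Sum>i\<in>{1..<d}. (t i / sqrt a)\<^sup>2)"
    using assms by (simp add: lessThan_eq_insert_0 lift_def a_def)
  also have "\<dots> = (1 + (\<Sum>i\<in>{1..<d}. (t i)\<^sup>2)) / a"
    using a by (simp add: power_divide add_divide_distrib flip: sum_divide_distrib)
  also have "\<dots> = 1" using a by (simp add: a_def)
  finally show ?thesis by (simp add: sphere_d_def lift_def)
qed

lemma sgnp_dotd_lift:
  assumes "0 < d"
  shows "sgnp (dotd d (lift d t) g) = sgnp (g 0 + (\<Sum>i\<in>{1..<d}. t i * g i))"
proof -
  define a where "a = sqrt (1 + (\<Sum>i\<in>{1..<d}. (t i)\<^sup>2))"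
  have a: "0 < a" by (simp add: a_def add_pos_nonneg sum_nonneg)
  have "dotd d (lift d t) g = (g 0 + (\<Sum>i\<in>{1..<d}. t i * g i)) / a"
    using assms by (simp add: dotd_def lessThan_eq_insert_0 lift_def a_def add_divide_distrib sum_divide_distrib)
  then show ?thesis using a by (simp add: sgnp_def zero_le_divide_iff)
qed

lemma sgnp_dotd_normalize:
  "sgnp (dotd d u (restrict (\<lambda>i. g i / sqrt (\<Sum>j<d. (g j)\<^sup>2)) {..<d})) = sgnp (dotd d u g)"
proof (cases "(\<Sum>j<d. (g j)\<^sup>2) = 0")
  \<comment> \<open>Division by zero yields 0, so both inner products vanish.\<close>
  case True
  then have "g i = 0" if "i < d" for i using that by (simp add: sum_nonneg_eq_0_iff)
  then have "dotd d u g = 0" by (simp add: dotd_def)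
  moreover have "dotd d u (restrict (\<lambda>i. g i / sqrt (\<Sum>j<d. (g j)\<^sup>2)) {..<d}) = 0"
    using True by (simp add: dotd_def)
  ultimately show ?thesis by simp
next
  case False
  then have "0 < (\<Sum>j<d. (g j)\<^sup>2)" by (simp add: order.not_eq_order_implies_strict sum_nonneg)
  moreover have "dotd d u (restrict (\<lambda>i. g i / sqrt (\<Sum>j<d. (g j)\<^sup>2)) {..<d})
      = dotd d u g / sqrt (\<Sum>j<d. (g j)\<^sup>2)"
    by (simp add: dotd_def sum_divide_distrib)
  ultimately show ?thesis by (simp add: sgnp_def zero_le_divide_iff)
qed

text \<open>Signs ignore positive scaling, so the point on the sphere may be replaced by the
  Gaussian vector, whose coordinates are independent.\<close>

lemma disagree_eq_gauss:
  "disagree d v u = measure (gauss_d d) {g \<in> space (gauss_d d). sgnp (dotd d v g) \<noteq> sgnp (dotd d u g)}"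
proof -
  let ?n = "\<lambda>g. restrict (\<lambda>i. g i / sqrt (\<Sum>j<d. (g j)\<^sup>2)) {..<d}"
  have f: "(\<lambda>x. sgnp (dotd d a x)) \<in> borel_measurable (PiM {..<d} (\<lambda>_. borel))" for a
    by measurable
  have "disagree d v u = measure (gauss_d d)
      (?n -` {x \<in> space (PiM {..<d} (\<lambda>_. borel)). sgnp (dotd d v x) \<noteq> sgnp (dotd d u x)} \<inter> space (gauss_d d))"
    unfolding disagree_def unif_sphere_def space_distr
    using borel_measurable_neq[OF f f] by (intro measure_distr normalize_measurable)
  also have "?n -` {x \<in> space (PiM {..<d} (\<lambda>_. borel)). sgnp (dotd d v x) \<noteq> sgnp (dotd d u x)} \<inter> space (gauss_d d)
      = {g \<in> space (gauss_d d). sgnp (dotd d v g) \<noteq> sgnp (dotd d u g)}"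
    using measurable_space[OF normalize_measurable[of d]]
    by (auto simp: sgnp_dotd_normalize simp del: restrict_apply)
  finally show ?thesis .
qed

lemma sgnp_neq_iff: "sgnp (x + a) \<noteq> sgnp (x + b) \<longleftrightarrow> - max a b \<le> x \<and> x < - min a b"
  by (auto simp: sgnp_def)

text \<open>Sum and difference appear because, for linear forms, both are again linear forms with
  known moments.\<close>

lemma abs_diff_cubes: "max a b ^ 3 - min a b ^ 3 = \<bar>a - b\<bar> * (3 * (a + b)\<^sup>2 + (a - b)\<^sup>2) / 4" for a b :: real
  by (cases "a \<le> b") (auto simp: max_def min_def power2_eq_square power3_eq_cube algebra_simps)

text \<open>Fubini in coordinate 0: the signs differ exactly when \<open>g 0\<close> falls between
  \<open>- L t g\<close> and \<open>- L s g\<close>, up to endpoints. Any integrable minorant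
  \<open>f\<close> is allowed, so the mixed cubic term can be estimated before integrating.\<close>

lemma disagree_lift_ge_integral:
  assumes d: "0 < d"
  defines "L \<equiv> \<lambda>t g. \<Sum>i\<in>{1..<d}. t i * g i"
  assumes int: "integrable (gauss_on {1..<d}) f"
    and f: "\<And>g. f g \<le> \<bar>L t g - L s g\<bar> - \<bar>L t g - L s g\<bar> * (3 * (L t g + L s g)\<^sup>2 + (L t g - L s g)\<^sup>2) / 24"
  shows "integral\<^sup>L (gauss_on {1..<d}) f / sqrt (2 * pi) \<le> disagree d (lift d t) (lift d s)"
proof -
  interpret N: prob_space "density lborel std_normal_density" by (rule prob_space_std_normal)
  interpret P: product_prob_space "\<lambda>_::nat. density lborel std_normal_density" "{..<d}"
    by (intro product_prob_spaceI prob_space_std_normal)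
  interpret G: prob_space "gauss_on {1..<d}" by (rule prob_space_gauss_on)
  define X where "X = {g \<in> space (gauss_d d). sgnp (dotd d (lift d t) g) \<noteq> sgnp (dotd d (lift d s) g)}"
  have m: "(\<lambda>x. sgnp (dotd d a x)) \<in> borel_measurable (gauss_d d)" for a
    by measurable
  have X: "X \<in> sets (gauss_d d)"
    unfolding X_def by (rule borel_measurable_neq[OF m m])
  have [measurable]: "L a \<in> borel_measurable (gauss_on {1..<d})" for a
    unfolding L_def by measurable
  let ?Y = "\<lambda>g. {- max (L t g) (L s g)..<- min (L t g) (L s g)}"
  have upd: "g(0 := x) \<in> X \<longleftrightarrow> x \<in> ?Y g" if "g \<in> space (gauss_on {1..<d})" for g x
  proof -
    have "g(0 := x) \<in> space (gauss_d d)"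
      using that d by (auto simp: gauss_d_def space_PiM PiE_def extensional_def)
    moreover have "sgnp (dotd d (lift d a) (g(0 := x))) = sgnp (x + L a g)" for a
      unfolding sgnp_dotd_lift[OF d] L_def by simp
    ultimately show ?thesis
      by (simp add: X_def sgnp_neq_iff)
  qed
  interpret GD: prob_space "gauss_d d" by (rule prob_space_gauss_d)
  have intX: "integrable (gauss_on (insert 0 {1..<d})) (indicator X :: _ \<Rightarrow> real)"
  proof -
    have "integrable (gauss_d d) (indicator X :: _ \<Rightarrow> real)"
      using X by (simp add: GD.emeasure_eq_measure)
    then show ?thesis unfolding gauss_d_def lessThan_eq_insert_0[OF d] .
  qed
  have "disagree d (lift d t) (lift d s) = integral\<^sup>L (gauss_d d) (indicator X)"
    using X by (simp add: disagree_eq_gauss X_def)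
  also have "\<dots> = (\<integral>g. (\<integral>x. indicator X (g(0 := x)) \<partial>density lborel std_normal_density) \<partial>gauss_on {1..<d})"
    unfolding gauss_d_def lessThan_eq_insert_0[OF d] using intX
    by (intro P.product_integral_insert) auto
  also have "\<dots> = (\<integral>g. N.prob (?Y g) \<partial>gauss_on {1..<d})"
  proof (intro Bochner_Integration.integral_cong refl)
    fix g assume "g \<in> space (gauss_on {1..<d})"
    then have "(\<lambda>x. indicator X (g(0 := x)) :: real) = indicator (?Y g)"
      by (auto simp: fun_eq_iff indicator_def upd)
    then show "(\<integral>x. indicator X (g(0 := x)) \<partial>density lborel std_normal_density) = N.prob (?Y g)"
      by simp
  qed
  finally have eq: "disagree d (lift d t) (lift d s) = (\<integral>g. N.prob (?Y g) \<partial>gauss_on {1..<d})" .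
  have le: "f g / sqrt (2 * pi) \<le> N.prob (?Y g)" for g
  proof -
    have "f g / sqrt (2 * pi) \<le> (\<bar>L t g - L s g\<bar> - (max (L t g) (L s g) ^ 3 - min (L t g) (L s g) ^ 3) / 6) / sqrt (2 * pi)"
      unfolding abs_diff_cubes using f[of g] by (intro divide_right_mono) auto
    also have "\<dots> \<le> N.prob (?Y g)"
      using std_normal_interval_ge[of "- max (L t g) (L s g)" "- min (L t g) (L s g)"]
      by (cases "L t g \<le> L s g") (simp_all add: max_def min_def power3_eq_cube)
    finally show ?thesis .
  qed
  have "(\<integral>g. f g / sqrt (2 * pi) \<partial>gauss_on {1..<d}) \<le> (\<integral>g. N.prob (?Y g) \<partial>gauss_on {1..<d})"
  proof (intro integral_mono le)
    show "integrable (gauss_on {1..<d}) (\<lambda>g. f g / sqrt (2 * pi))" using int by simp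
    show "integrable (gauss_on {1..<d}) (\<lambda>g. N.prob (?Y g))"
    proof (rule G.integrable_const_bound[of _ 1])
      \<comment> \<open>Written as an integral over \<open>x\<close> with parameter
        \<open>g\<close>, the mass of the moving interval is visibly measurable in
        \<open>g\<close>.\<close>
      have "(\<lambda>g. N.prob (?Y g)) = (\<lambda>g. \<integral>x. (if - max (L t g) (L s g) \<le> x \<and> x < - min (L t g) (L s g)
          then 1 else 0) \<partial>density lborel std_normal_density)"
      proof
        fix g
        have "N.prob (?Y g) = (\<integral>x. indicator (?Y g) x \<partial>density lborel std_normal_density)"
          by simp
        also have "\<dots> = (\<integral>x. (if - max (L t g) (L s g) \<le> x \<and> x < - min (L t g) (L s g)
          then 1 else 0) \<partial>density lborel std_normal_density)"
          by (intro Bochner_Integration.integral_cong) (auto simp: indicator_def)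
        finally show "N.prob (?Y g) = \<dots>" .
      qed
      also have "\<dots> \<in> borel_measurable (gauss_on {1..<d})"
        by measurable
      finally show "(\<lambda>g. N.prob (?Y g)) \<in> borel_measurable (gauss_on {1..<d})" .
    qed auto
  qed
  then show ?thesis by (simp add: eq)
qed

text \<open>AM-GM, \<open>\<bar>x\<bar> \<le> (x\<^sup>2 / \<delta> + \<delta>) / 2\<close>, reduces the error term to moments of order two and four,
  which are known for every single linear form.\<close>

lemma disagree_lift_ge:
  fixes t s :: "nat \<Rightarrow> real"
  assumes d: "0 < d"
  defines "sq \<equiv> \<lambda>t. \<Sum>i\<in>{1..<d}. (t i)\<^sup>2"
  defines "\<Delta> \<equiv> sq (\<lambda>i. t i - s i)" and "\<Sigma> \<equiv> sq (\<lambda>i. t i + s i)"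
  assumes \<Delta>: "0 < \<Delta>"
  shows "sqrt \<Delta> / sqrt (2 * pi) * (sqrt (2 / pi) -
    (3 * (4 * (sq t)\<^sup>2 + 4 * (sq s)\<^sup>2 - (\<Delta>\<^sup>2 + \<Sigma>\<^sup>2) / 2) / \<Delta> + 4 * \<Delta> + 3 * \<Sigma>) / 48)
    \<le> disagree d (lift d t) (lift d s)"
proof -
  define L where "L t g = (\<Sum>i\<in>{1..<d}. t i * g i)" for t g :: "nat \<Rightarrow> real"
  define r where "r = sqrt \<Delta>"
  have r: "0 < r" "r\<^sup>2 = \<Delta>" using \<Delta> by (simp_all add: r_def)
  define D where "D = L (\<lambda>i. t i - s i)"
  define S where "S = L (\<lambda>i. t i + s i)"
  have D: "D g = L t g - L s g" and S: "S g = L t g + L s g" for g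
    by (simp_all add: D_def S_def L_def algebra_simps sum.distrib sum_subtractf)
  \<comment> \<open>AM-GM at the scale \<open>r\<close>, the standard deviation of \<open>D\<close>.
    The product of the squares of \<open>D\<close> and \<open>S\<close> is replaced by fourth powers
    of single forms, by the identity \<open>p\<close> below.\<close>
  define f where "f g = \<bar>D g\<bar> - ((8 * (L t g) ^ 4 + 8 * (L s g) ^ 4 - (D g) ^ 4 - (S g) ^ 4) / (2 * r)
      + (D g) ^ 4 / r + 3 * r * (S g)\<^sup>2 + r * (D g)\<^sup>2) / 48" for g
  have mom: "has_bochner_integral (gauss_on {1..<d}) (\<lambda>g. \<bar>L a g\<bar>) (sqrt (2 / pi) * sqrt (sq a))"
    "has_bochner_integral (gauss_on {1..<d}) (\<lambda>g. (L a g)\<^sup>2) (sq a)"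
    "has_bochner_integral (gauss_on {1..<d}) (\<lambda>g. (L a g) ^ 4) (3 * (sq a)\<^sup>2)" for a
    unfolding L_def sq_def by (rule linear_form_moments; simp)+
  note D1 = mom(1)[of "\<lambda>i. t i - s i", folded D_def \<Delta>_def]
    and D2 = mom(2)[of "\<lambda>i. t i - s i", folded D_def \<Delta>_def]
    and D4 = mom(3)[of "\<lambda>i. t i - s i", folded D_def \<Delta>_def]
    and S2 = mom(2)[of "\<lambda>i. t i + s i", folded S_def \<Sigma>_def]
    and S4 = mom(3)[of "\<lambda>i. t i + s i", folded S_def \<Sigma>_def]
  have hf: "has_bochner_integral (gauss_on {1..<d}) f (sqrt (2 / pi) * sqrt \<Delta> -
      ((8 * (3 * (sq t)\<^sup>2) + 8 * (3 * (sq s)\<^sup>2) - 3 * \<Delta>\<^sup>2 - 3 * \<Sigma>\<^sup>2) / (2 * r)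
      + (3 * \<Delta>\<^sup>2) / r + 3 * r * \<Sigma> + r * \<Delta>) / 48)"
    unfolding f_def
    by (intro has_bochner_integral_diff has_bochner_integral_add has_bochner_integral_divide_zero
      has_bochner_integral_mult_right mom D1 D2 D4 S2 S4) 
  have "integral\<^sup>L (gauss_on {1..<d}) f / sqrt (2 * pi) \<le> disagree d (lift d t) (lift d s)"
  proof (rule disagree_lift_ge_integral[OF d])
    show "integrable (gauss_on {1..<d}) f" using hf by (simp add: has_bochner_integral_iff)
    fix g
    have half: "z - w / 48 \<le> z - v / 24" if "v \<le> w / 2" for v w z :: real
      using that by simp
    define x y where "x = L t g" and "y = L s g"
    have "\<bar>x - y\<bar> \<le> ((x - y)\<^sup>2 / r + r) / 2"
    proof -
      have "0 \<le> (\<bar>x - y\<bar> - r)\<^sup>2 / r" using r by simp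
      also have "\<dots> = (x - y)\<^sup>2 / r + r - 2 * \<bar>x - y\<bar>"
        using r(1) by (simp add: power2_diff add_divide_distrib diff_divide_distrib) (simp add: power2_eq_square)
      finally show ?thesis by simp
    qed
    then have "\<bar>x - y\<bar> * (3 * (x + y)\<^sup>2 + (x - y)\<^sup>2) \<le> ((x - y)\<^sup>2 / r + r) / 2 * (3 * (x + y)\<^sup>2 + (x - y)\<^sup>2)"
      by (intro mult_right_mono) auto
    also have "\<dots> = ((8 * x ^ 4 + 8 * y ^ 4 - (x - y) ^ 4 - (x + y) ^ 4) / (2 * r)
      + (x - y) ^ 4 / r + 3 * r * (x + y)\<^sup>2 + r * (x - y)\<^sup>2) / 2"
    proof -
      have p: "8 * x ^ 4 + 8 * y ^ 4 - (x - y) ^ 4 - (x + y) ^ 4 = 6 * ((x - y)\<^sup>2 * (x + y)\<^sup>2)"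
        by (simp add: power2_eq_square power4_eq_xxxx algebra_simps)
      have q: "(x - y) ^ 4 = (x - y)\<^sup>2 * (x - y)\<^sup>2" by (simp flip: power_add)
      show ?thesis unfolding p unfolding q using r(1) by (simp add: field_simps)
    qed
    finally show "f g \<le> \<bar>(\<Sum>i\<in>{1..<d}. t i * g i) - (\<Sum>i\<in>{1..<d}. s i * g i)\<bar> -
        \<bar>(\<Sum>i\<in>{1..<d}. t i * g i) - (\<Sum>i\<in>{1..<d}. s i * g i)\<bar> *
        (3 * ((\<Sum>i\<in>{1..<d}. t i * g i) + (\<Sum>i\<in>{1..<d}. s i * g i))\<^sup>2 +
         ((\<Sum>i\<in>{1..<d}. t i * g i) - (\<Sum>i\<in>{1..<d}. s i * g i))\<^sup>2) / 24"
      unfolding f_def D S L_def[symmetric] x_def y_def by (rule half)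
  qed
  moreover have "integral\<^sup>L (gauss_on {1..<d}) f = r * (sqrt (2 / pi) -
    (3 * (4 * (sq t)\<^sup>2 + 4 * (sq s)\<^sup>2 - (\<Delta>\<^sup>2 + \<Sigma>\<^sup>2) / 2) / \<Delta> + 4 * \<Delta> + 3 * \<Sigma>) / 48)"
    unfolding has_bochner_integral_integral_eq[OF hf] r(2)[symmetric] using r(1)
    by (simp add: field_simps power2_eq_square)
  ultimately show ?thesis by (simp add: r_def)
qed

text \<open>Isolates the leading term \<open>sqrt \<Delta> / pi\<close>; \<open>1.2534\<close> is a
  rational upper bound for \<open>sqrt (pi / 2)\<close>, the relative size of the error
  \<open>q\<close>.\<close>

lemma disagree_lift_ge_pi:
  fixes t s :: "nat \<Rightarrow> real"
  assumes d: "0 < d"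
  defines "sq \<equiv> \<lambda>t. \<Sum>i\<in>{1..<d}. (t i)\<^sup>2"
  defines "\<Delta> \<equiv> sq (\<lambda>i. t i - s i)" and "\<Sigma> \<equiv> sq (\<lambda>i. t i + s i)"
  assumes \<Delta>: "0 < \<Delta>" and q: "0 \<le> q"
    "(3 * (4 * (sq t)\<^sup>2 + 4 * (sq s)\<^sup>2 - (\<Delta>\<^sup>2 + \<Sigma>\<^sup>2) / 2) / \<Delta> + 4 * \<Delta> + 3 * \<Sigma>) / 48 \<le> q"
  shows "sqrt \<Delta> * (1 - 1.2534 * q) / pi \<le> disagree d (lift d t) (lift d s)"
proof -
  have "sqrt (pi / 2) \<le> 1.2534"
    using pi_approx by (intro real_le_lsqrt) (auto simp: power2_eq_square)
  then have "sqrt \<Delta> * (1 - 1.2534 * q) / pi \<le> sqrt \<Delta> * (1 - sqrt (pi / 2) * q) / pi"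
    using \<Delta> q(1) by (intro divide_right_mono mult_left_mono diff_left_mono mult_right_mono) auto
  also have "\<dots> = sqrt \<Delta> / sqrt (2 * pi) * (sqrt (2 / pi) - q)"
  proof -
    define a where "a = sqrt (2 * pi)"
    have a: "0 < a" "pi = a\<^sup>2 / 2" by (simp_all add: a_def)
    have half: "sqrt (pi / 2) = a / 2" by (rule real_sqrt_unique) (simp_all add: power_divide a_def)
    have inv: "sqrt (2 / pi) = 2 / a" by (rule real_sqrt_unique) (simp_all add: power_divide a_def)
    have "x * (1 - a / 2 * q) / pi = x / a * (2 / a - q)" for x
      unfolding a(2) using a(1) by (simp add: field_simps power2_eq_square)
    then show ?thesis unfolding half inv a_def[symmetric] .
  qed
  also have "\<dots> \<le> sqrt \<Delta> / sqrt (2 * pi) * (sqrt (2 / pi) -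
    (3 * (4 * (sq t)\<^sup>2 + 4 * (sq s)\<^sup>2 - (\<Delta>\<^sup>2 + \<Sigma>\<^sup>2) / 2) / \<Delta> + 4 * \<Delta> + 3 * \<Sigma>) / 48)"
    using \<Delta> q(2) by (intro mult_left_mono diff_left_mono) auto
  also have "\<dots> \<le> disagree d (lift d t) (lift d s)"
    using \<Delta> unfolding \<Delta>_def \<Sigma>_def sq_def by (intro disagree_lift_ge d)
  finally show ?thesis .
qed

lemma sum_squares_parallelogram:
  fixes t s :: "nat \<Rightarrow> real"
  shows "(\<Sum>i\<in>I. (t i - s i)\<^sup>2) + (\<Sum>i\<in>I. (t i + s i)\<^sup>2) = 2 * (\<Sum>i\<in>I. (t i)\<^sup>2) + 2 * (\<Sum>i\<in>I. (s i)\<^sup>2)"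
  by (simp add: power2_sum power2_diff sum.distrib sum_subtractf)

text \<open>The value \<open>3/5\<close> nearly maximises the resulting bound, which at the largest admissible
  \<open>\<epsilon> = 1 / (4 * pi)\<close> has to exceed \<open>2 * \<epsilon>\<close>.\<close>

lemma disagree_lift_coarse:
  assumes d: "0 < d"
    and t: "(\<Sum>i\<in>{1..<d}. (t i)\<^sup>2) = 3 / 5" and s: "(\<Sum>i\<in>{1..<d}. (s i)\<^sup>2) = 3 / 5"
    and \<Delta>: "3 / 5 \<le> (\<Sum>i\<in>{1..<d}. (t i - s i)\<^sup>2)"
  shows "1 / (2 * pi) < disagree d (lift d t) (lift d s)"
proof -
  define D where "D = (\<Sum>i\<in>{1..<d}. (t i - s i)\<^sup>2)"
  define S where "S = (\<Sum>i\<in>{1..<d}. (t i + s i)\<^sup>2)"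
  have S: "S = 12 / 5 - D"
    using sum_squares_parallelogram[of t s "{1..<d}"] unfolding t s D_def S_def by linarith
  have D: "3 / 5 \<le> D" using \<Delta> by (simp add: D_def)
  have "(3 * (4 * (3 / 5)\<^sup>2 + 4 * (3 / 5)\<^sup>2 - (D\<^sup>2 + S\<^sup>2) / 2) / D + 4 * D + 3 * S) / 48 = 3 / 10 - D / 24"
  proof -
    have "4 * (3 / 5)\<^sup>2 + 4 * (3 / 5)\<^sup>2 - (D\<^sup>2 + S\<^sup>2) / 2 = D * S"
      unfolding S by (simp add: power2_eq_square field_simps)
    then show ?thesis using D by (simp add: S)
  qed
  also have "\<dots> \<le> 11 / 40" using D by simp
  finally have le: "(3 * (4 * (3 / 5)\<^sup>2 + 4 * (3 / 5)\<^sup>2 - (D\<^sup>2 + S\<^sup>2) / 2) / D + 4 * D + 3 * S) / 48 \<le> 11 / 40" .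
  have "sqrt D * (1 - 1.2534 * (11 / 40)) / pi \<le> disagree d (lift d t) (lift d s)"
    using D by (intro disagree_lift_ge_pi[OF d, of t s "11 / 40", folded D_def S_def, unfolded t s, OF _ _ le]) auto
  \<comment> \<open>\<open>0.7745\<close> lies just below \<open>sqrt (3/5)\<close>; its product
    with the bracket is about \<open>0.507\<close>, narrowly above the required
    \<open>1/2\<close>.\<close>
  moreover have "0.7745 \<le> sqrt D"
    using D by (intro real_le_rsqrt) (simp add: power2_eq_square)
  then have "0.7745 * (1 - 1.2534 * (11 / 40)) / pi \<le> sqrt D * (1 - 1.2534 * (11 / 40)) / pi"
    by (intro divide_right_mono mult_right_mono) auto
  moreover have "1 / (2 * pi) < 0.7745 * (1 - 1.2534 * (11 / 40)) / pi"
    by (simp add: field_simps)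
  ultimately show ?thesis by linarith
qed

text \<open>The squared norms \<open>P\<close> and \<open>Q\<close> may now differ, but
  \<open>(P - Q)\<^sup>2 \<le> D * S\<close> by Cauchy-Schwarz. Dividing by \<open>D\<close> is then
  harmless, the error stays below \<open>3/5\<close> however close the points are, and
  \<open>1 - 1.2534 * (3/5)\<close> exceeds \<open>6/25\<close>.\<close>

lemma disagree_lift_fine:
  assumes d: "0 < d"
    and t: "(\<Sum>i\<in>{1..<d}. (t i)\<^sup>2) \<le> 3 / 5" and s: "(\<Sum>i\<in>{1..<d}. (s i)\<^sup>2) \<le> 3 / 5"
    and \<rho>: "0 < \<rho>" "\<rho>\<^sup>2 \<le> (\<Sum>i\<in>{1..<d}. (t i - s i)\<^sup>2)"
  shows "6 / 25 * \<rho> / pi \<le> disagree d (lift d t) (lift d s)"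
proof -
  define P where "P = (\<Sum>i\<in>{1..<d}. (t i)\<^sup>2)"
  define Q where "Q = (\<Sum>i\<in>{1..<d}. (s i)\<^sup>2)"
  define D where "D = (\<Sum>i\<in>{1..<d}. (t i - s i)\<^sup>2)"
  define S where "S = (\<Sum>i\<in>{1..<d}. (t i + s i)\<^sup>2)"
  have DS: "D + S = 2 * P + 2 * Q"
    using sum_squares_parallelogram[of t s "{1..<d}"] by (simp add: P_def Q_def D_def S_def)
  have D: "0 < D" unfolding D_def using \<rho>(2) zero_less_power[OF \<rho>(1), of 2] by linarith
  have S0: "0 \<le> S" by (simp add: S_def sum_nonneg)
  have "P - Q = (\<Sum>i\<in>{1..<d}. (t i - s i) * (t i + s i))"
    by (simp add: P_def Q_def power2_eq_square algebra_simps sum_subtractf sum.distrib)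
  then have PQ: "(P - Q)\<^sup>2 \<le> D * S"
    using Cauchy_Schwarz_ineq_sum[of "\<lambda>i. t i - s i" "\<lambda>i. t i + s i" "{1..<d}"]
    by (simp add: D_def S_def)
  have "4 * P\<^sup>2 + 4 * Q\<^sup>2 - (D\<^sup>2 + S\<^sup>2) / 2 = D * S + 2 * (P - Q)\<^sup>2"
  proof -
    have S: "S = 2 * P + 2 * Q - D" using DS by simp
    show ?thesis unfolding S by (simp add: power2_eq_square field_simps)
  qed
  also have "\<dots> \<le> 3 * S * D" using PQ by simp
  finally have "3 * (4 * P\<^sup>2 + 4 * Q\<^sup>2 - (D\<^sup>2 + S\<^sup>2) / 2) / D \<le> 3 * (3 * S * D) / D"
    using D by (intro divide_right_mono mult_left_mono) auto
  also have "\<dots> = 9 * S" using D by simp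
  finally have "3 * (4 * P\<^sup>2 + 4 * Q\<^sup>2 - (D\<^sup>2 + S\<^sup>2) / 2) / D \<le> 9 * S" .
  moreover have "P \<le> 3 / 5" "Q \<le> 3 / 5" using t s by (simp_all add: P_def Q_def)
  moreover have "(x + 4 * D + 3 * S) / 48 \<le> 3 / 5" if "x \<le> 9 * S" "P \<le> 3 / 5" "Q \<le> 3 / 5" for x
    using that D S0 DS by simp
  ultimately have le: "(3 * (4 * P\<^sup>2 + 4 * Q\<^sup>2 - (D\<^sup>2 + S\<^sup>2) / 2) / D + 4 * D + 3 * S) / 48 \<le> 3 / 5"
    by blast
  have "sqrt D * (1 - 1.2534 * (3 / 5)) / pi \<le> disagree d (lift d t) (lift d s)"
    using D by (intro disagree_lift_ge_pi[OF d, of t s "3 / 5", folded D_def S_def P_def Q_def, OF _ _ le]) auto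
  moreover have "\<rho> \<le> sqrt D" using \<rho> by (intro real_le_rsqrt) (simp add: D_def)
  then have "\<rho> * (6 / 25) / pi \<le> sqrt D * (1 - 1.2534 * (3 / 5)) / pi"
    using \<rho>(1) D by (intro divide_right_mono mult_mono) auto
  ultimately show ?thesis by (simp add: mult.commute)
qed

subsection \<open>The packing\<close>

text \<open>Letters become equally spaced points of \<open>[-1, 1]\<close>, scaled to squared norm
  at most \<open>3/5\<close>, with equality for \<open>K = 2\<close>. The shift \<open>i - 1\<close>
  leaves coordinate 0 to the entry 1 of \<open>lift\<close>.\<close>

definition grid_point :: "nat \<Rightarrow> nat \<Rightarrow> (nat \<Rightarrow> nat) \<Rightarrow> nat \<Rightarrow> real" where
  "grid_point m K w i = sqrt (3 / (5 * real m)) * (2 * real (w (i - 1)) / (real K - 1) - 1)"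

lemma sum_from_1: "(\<Sum>i\<in>{1..<Suc m}. f (i - 1)) = (\<Sum>j<m. f j)" for f :: "nat \<Rightarrow> real"
  using sum.shift_bounds_Suc_ivl[of "\<lambda>i. f (i - 1)" 0 m] by (simp add: atLeast0LessThan)

lemma sum_sq_grid_point:
  assumes "0 < m"
  shows "(\<Sum>i\<in>{1..<Suc m}. (grid_point m K w i)\<^sup>2)
    = 3 / (5 * real m) * (\<Sum>j<m. (2 * real (w j) / (real K - 1) - 1)\<^sup>2)"
  using assms sum_from_1[of "\<lambda>j. (sqrt (3 / (5 * real m)) * (2 * real (w j) / (real K - 1) - 1))\<^sup>2" m]
  by (simp add: grid_point_def power_mult_distrib sum_distrib_left)

lemma sum_sq_grid_point_le:
  assumes m: "0 < m" and K: "2 \<le> K" and w: "w \<in> words m K"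
  shows "(\<Sum>i\<in>{1..<Suc m}. (grid_point m K w i)\<^sup>2) \<le> 3 / 5"
proof -
  have "(\<Sum>j<m. (2 * real (w j) / (real K - 1) - 1)\<^sup>2) \<le> (\<Sum>j<m. 1)"
  proof (rule sum_mono)
    fix j assume "j \<in> {..<m}"
    then have "w j < K" using w by (auto simp: words_def)
    then have "real (w j) \<le> real K - 1" by linarith
    then have "\<bar>2 * real (w j) / (real K - 1) - 1\<bar> \<le> 1" using K by (auto simp: abs_le_iff field_simps)
    then show "(2 * real (w j) / (real K - 1) - 1)\<^sup>2 \<le> 1" by (simp add: abs_square_le_1)
  qed
  then have "3 / (5 * real m) * (\<Sum>j<m. (2 * real (w j) / (real K - 1) - 1)\<^sup>2) \<le> 3 / (5 * real m) * real m"
    by (intro mult_left_mono) auto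
  then show ?thesis unfolding sum_sq_grid_point[OF m] using m by simp
qed

lemma sum_sq_grid_point_binary:
  assumes m: "0 < m" and w: "w \<in> words m 2"
  shows "(\<Sum>i\<in>{1..<Suc m}. (grid_point m 2 w i)\<^sup>2) = 3 / 5"
proof -
  have "(\<Sum>j<m. (2 * real (w j) / (real 2 - 1) - 1)\<^sup>2) = (\<Sum>j<m. 1)"
  proof (intro sum.cong refl)
    fix j assume "j \<in> {..<m}"
    then have "w j \<in> {..<2}" using w unfolding words_def by (rule PiE_mem[rotated])
    then have "w j = 0 \<or> w j = 1" by (simp add: less_2_cases_iff)
    then show "(2 * real (w j) / (real 2 - 1) - 1)\<^sup>2 = 1" by auto
  qed
  then show ?thesis unfolding sum_sq_grid_point[OF m] using m by simp
qed

text \<open>At least \<open>m / 4\<close> coordinates differ, each by at least one grid step, which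
  is \<open>2 / (K - 1)\<close> before scaling.\<close>

lemma sum_sq_grid_point_diff:
  assumes m: "0 < m" and K: "2 \<le> K" and h: "m \<le> 4 * hamming m w w'"
  shows "3 / (5 * (real K - 1)\<^sup>2) \<le> (\<Sum>i\<in>{1..<Suc m}. (grid_point m K w i - grid_point m K w' i)\<^sup>2)"
proof -
  have "real (hamming m w w') = (\<Sum>j<m. if w j \<noteq> w' j then 1 else 0)"
    by (simp add: hamming_def sum.If_cases Int_def)
  also have "\<dots> \<le> (\<Sum>j<m. (real (w j) - real (w' j))\<^sup>2)"
  proof (rule sum_mono)
    fix j
    show "(if w j \<noteq> w' j then 1 else 0) \<le> (real (w j) - real (w' j))\<^sup>2"
    proof (cases "w j = w' j")
      case False
      then have "1 \<le> \<bar>real (w j) - real (w' j)\<bar>" by linarith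
      then have "1\<^sup>2 \<le> \<bar>real (w j) - real (w' j)\<bar>\<^sup>2" by (intro power_mono) auto
      then show ?thesis by simp
    qed simp
  qed
  finally have "real m / 4 \<le> (\<Sum>j<m. (real (w j) - real (w' j))\<^sup>2)" using h by linarith
  then have "3 / (5 * real m) * (2 / (real K - 1))\<^sup>2 * (real m / 4)
      \<le> 3 / (5 * real m) * (2 / (real K - 1))\<^sup>2 * (\<Sum>j<m. (real (w j) - real (w' j))\<^sup>2)"
    by (intro mult_left_mono) auto
  also have "\<dots> = (\<Sum>j<m. (sqrt (3 / (5 * real m)) * (2 / (real K - 1) * (real (w j) - real (w' j))))\<^sup>2)"
  proof -
    have "(sqrt (3 / (5 * real m)))\<^sup>2 = 3 / (5 * real m)" by simp
    then show ?thesis by (simp only: sum_distrib_left power_mult_distrib mult.assoc)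
  qed
  also have "\<dots> = (\<Sum>i\<in>{1..<Suc m}. (grid_point m K w i - grid_point m K w' i)\<^sup>2)"
    unfolding sum_from_1[symmetric, of _ m]
    by (intro sum.cong refl) (simp add: grid_point_def diff_divide_distrib algebra_simps)
  finally show ?thesis using m by (simp add: power_divide)
qed

lemma exists_packing:
  assumes d: "4 < d" and \<epsilon>: "0 < \<epsilon>" "\<epsilon> \<le> 1 / (4 * pi)"
  shows "\<exists>U. finite U \<and> U \<subseteq> sphere_d d \<and> 2 \<le> card U \<and>
    (\<forall>u\<in>U. \<forall>u'\<in>U. u \<noteq> u' \<longrightarrow> 2 * \<epsilon> < disagree d u u') \<and>
    real d * ln (1 / \<epsilon>) / 70 \<le> ln (real (card U))"
proof -
  define m where "m = d - 1"
  have m: "4 \<le> m" "d = Suc m" using d by (auto simp: m_def)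
  \<comment> \<open>The grid has about \<open>1 / (40 * \<epsilon>)\<close> values, or two when
    \<epsilon> is large, where \<open>2 ^ 7 > 80\<close> suffices. The seventh power costs only a
    factor 7 in the logarithm.\<close>
  have "\<exists>K. 2 \<le> K \<and> 1 / \<epsilon> \<le> real K ^ 7 \<and> (K = 2 \<or> (real K - 1) * (40 * \<epsilon>) \<le> 1)"
  proof (cases "\<epsilon> \<le> 1 / 80")
    case False
    then show ?thesis using \<epsilon> by (intro exI[of _ 2]) (auto simp: field_simps)
  next
    case True
    define k where "k = nat \<lfloor>1 / (40 * \<epsilon>)\<rfloor>"
    have ge2: "2 \<le> 1 / (40 * \<epsilon>)" using True \<epsilon> by (simp add: field_simps)
    then have k: "2 \<le> k" by (simp add: k_def le_nat_floor)
    have "0 \<le> \<lfloor>1 / (40 * \<epsilon>)\<rfloor>" using \<epsilon> by simp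
    then have rk: "real k = of_int \<lfloor>1 / (40 * \<epsilon>)\<rfloor>" by (simp only: k_def of_nat_nat)
    have k1: "real k \<le> 1 / (40 * \<epsilon>)" "1 / (40 * \<epsilon>) \<le> real k + 1" unfolding rk by linarith+
    have "1 / \<epsilon> = 40 * (1 / (40 * \<epsilon>))" using \<epsilon> by simp
    also have "\<dots> \<le> 3 ^ 6 * real (Suc k)" using k1(2) ge2 by simp
    also have "\<dots> \<le> real (Suc k) ^ 6 * real (Suc k)"
      using k by (intro mult_right_mono power_mono) auto
    finally have "1 / \<epsilon> \<le> real (Suc k) ^ 7" by (simp add: power_eq_if mult_ac)
    then show ?thesis
      using k k1(1) \<epsilon> by (intro exI[of _ "Suc k"]) (auto simp: field_simps)
  qed
  then obtain K where K: "2 \<le> K" "1 / \<epsilon> \<le> real K ^ 7" and K': "K = 2 \<or> (real K - 1) * (40 * \<epsilon>) \<le> 1"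
    by blast
  obtain C where C: "C \<subseteq> words m K" "\<And>w w'. w \<in> C \<Longrightarrow> w' \<in> C \<Longrightarrow> w \<noteq> w' \<Longrightarrow> m \<le> 4 * hamming m w w'"
      "real K ^ m \<le> real (card C) ^ 8"
    using exists_code[OF K(1), of m] m by auto
  define point where "point w = lift d (grid_point m K w)" for w
  have far: "2 * \<epsilon> < disagree d (point w) (point w')" if w: "w \<in> C" "w' \<in> C" "w \<noteq> w'" for w w'
  proof -
    have diff: "3 / (5 * (real K - 1)\<^sup>2) \<le> (\<Sum>i\<in>{1..<d}. (grid_point m K w i - grid_point m K w' i)\<^sup>2)"
      unfolding m(2) using m(1) K(1) C(2)[OF w] by (intro sum_sq_grid_point_diff) auto
    consider "K = 2" | "(real K - 1) * (40 * \<epsilon>) \<le> 1" using K' by blast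
    then show ?thesis
    proof cases
      case 1
      have "1 / (2 * pi) < disagree d (point w) (point w')"
        unfolding point_def
      proof (rule disagree_lift_coarse)
        show "(\<Sum>i\<in>{1..<d}. (grid_point m K w i)\<^sup>2) = 3 / 5" "(\<Sum>i\<in>{1..<d}. (grid_point m K w' i)\<^sup>2) = 3 / 5"
          unfolding m(2) 1 using m(1) w C(1) 1 by (intro sum_sq_grid_point_binary; auto)+
        show "3 / 5 \<le> (\<Sum>i\<in>{1..<d}. (grid_point m K w i - grid_point m K w' i)\<^sup>2)"
          using diff 1 by simp
      qed (use d in simp)
      moreover have "2 * \<epsilon> \<le> 1 / (2 * pi)" using \<epsilon> by (simp add: field_simps)
      ultimately show ?thesis by linarith
    next
      case 2
      define \<rho> where "\<rho> = 0.7745 / (real K - 1)"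
      have "6 / 25 * \<rho> / pi \<le> disagree d (point w) (point w')"
        unfolding point_def
      proof (rule disagree_lift_fine)
        show "(\<Sum>i\<in>{1..<d}. (grid_point m K w i)\<^sup>2) \<le> 3 / 5" "(\<Sum>i\<in>{1..<d}. (grid_point m K w' i)\<^sup>2) \<le> 3 / 5"
          unfolding m(2) using m(1) K(1) w C(1) by (intro sum_sq_grid_point_le; auto)+
        have "\<rho>\<^sup>2 \<le> 3 / (5 * (real K - 1)\<^sup>2)"
        proof -
          have "\<rho>\<^sup>2 = 0.7745\<^sup>2 / (real K - 1)\<^sup>2" by (simp only: \<rho>_def power_divide)
          also have "\<dots> \<le> (3 / 5) / (real K - 1)\<^sup>2"
            by (intro divide_right_mono) (auto simp: power2_eq_square)
          finally show ?thesis by simp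
        qed
        with diff show "\<rho>\<^sup>2 \<le> (\<Sum>i\<in>{1..<d}. (grid_point m K w i - grid_point m K w' i)\<^sup>2)" by simp
        show "0 < \<rho>" using K(1) by (simp add: \<rho>_def)
      qed (use d in simp)
      \<comment> \<open>The 40 in the choice of \<open>K\<close> pays off here:
        \<open>0.7745 * 40 > 30\<close>, and \<open>6/25 * 30 = 7.2\<close> exceeds
        \<open>2 * pi\<close>.\<close>
      moreover have "30 * \<epsilon> \<le> \<rho>" using 2 K(1) \<epsilon> by (simp add: \<rho>_def field_simps)
      then have "6 / 25 * (30 * \<epsilon>) / pi \<le> 6 / 25 * \<rho> / pi"
        by (intro divide_right_mono mult_left_mono) auto
      moreover have "2 * \<epsilon> < 6 / 25 * (30 * \<epsilon>) / pi"
        using \<epsilon> pi_approx by (simp add: field_simps)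
      ultimately show ?thesis by linarith
    qed
  qed
  have fin: "finite C" using C(1) by (rule finite_subset) simp
  have inj: "inj_on point C"
  proof (rule inj_onI, rule ccontr)
    fix w w' assume "w \<in> C" "w' \<in> C" "point w = point w'" "w \<noteq> w'"
    then have "2 * \<epsilon> < disagree d (point w) (point w)" using far[of w w'] by simp
    then show False using \<epsilon> by (simp add: disagree_def)
  qed
  have card: "card (point ` C) = card C" by (rule card_image[OF inj])
  have K1: "1 \<le> real K" using K(1) by simp
  have "0 < real K ^ m" using K(1) by simp
  with C(3) have "card C \<noteq> 0" by (cases "card C = 0") auto
  moreover have "card C \<noteq> 1"
  proof
    assume "card C = 1"
    then have "real K ^ m \<le> 1" using C(3) by simp
    moreover have "real K ^ 1 \<le> real K ^ m" using m(1) K1 by (intro power_increasing) auto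
    ultimately have "real K ^ 1 \<le> 1" by (rule order_trans[rotated])
    then show False using K(1) by simp
  qed
  ultimately have card2: "2 \<le> card C" by linarith
  have ln\<epsilon>: "ln (1 / \<epsilon>) \<le> 7 * ln (real K)"
  proof -
    have "ln (1 / \<epsilon>) \<le> ln (real K ^ 7)" using K \<epsilon> by (subst ln_le_cancel_iff) auto
    then show ?thesis using K1 by (simp add: ln_realpow)
  qed
  \<comment> \<open>The constant is \<open>70 = 5/4 * 7 * 8\<close>: \<open>d \<le> 5/4 * m\<close>
    since \<open>m \<ge> 4\<close>, then 7 from the choice of \<open>K\<close> and 8 from the size
    of the code.\<close>
  have "real d * ln (1 / \<epsilon>) \<le> real d * (7 * ln (real K))"
    by (intro mult_left_mono ln\<epsilon>) auto
  also have "\<dots> \<le> 5 / 4 * real m * (7 * ln (real K))"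
    using m K1 by (intro mult_right_mono) auto
  also have "\<dots> = 35 / 4 * ln (real K ^ m)" using K1 by (simp add: ln_realpow)
  also have "ln (real K ^ m) \<le> ln (real (card C) ^ 8)"
    using C(3) K1 card2 by (subst ln_le_cancel_iff) auto
  also have "\<dots> = 8 * ln (real (card C))" using card2 by (simp add: ln_realpow)
  finally have "real d * ln (1 / \<epsilon>) / 70 \<le> ln (real (card C))" by simp
  moreover have "point ` C \<subseteq> sphere_d d" using d by (auto simp: point_def intro: lift_in_sphere)
  ultimately show ?thesis
    using fin far card2 by (intro exI[of _ "point ` C"]) (auto simp: card)
qed

subsection \<open>The lower bound\<close>

theorem theorem1:
  shows "\<exists>c>0. \<forall>(d::nat) (\<eta>::real) (\<epsilon>::real) (\<delta>::real) (A::algorithm).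
     d > 4 \<longrightarrow> 0 \<le> \<eta> \<longrightarrow> \<eta> < 1/2 \<longrightarrow> 0 < \<epsilon> \<longrightarrow> \<epsilon> \<le> 1 / (4 * pi) \<longrightarrow>
     0 < \<delta> \<longrightarrow> \<delta> \<le> 1/4 \<longrightarrow>
     (\<exists>u \<in> sphere_d d. \<exists>p. bounded_noise_oracle d \<eta> u p \<and>
        (\<forall>n::nat. measure run_space (success_event d A p u \<epsilon> n) \<ge> 1 - \<delta> \<longrightarrow>
           real n \<ge> c * (real d * ln (1/\<epsilon>) / (1 - 2*\<eta>)\<^sup>2
                        + \<eta> * ln (1/\<delta>) / (1 - 2*\<eta>)\<^sup>2)))"
proof (intro exI[of _ "1 / 1120 :: real"] conjI allI impI)
  fix d :: nat and \<eta> \<epsilon> \<delta> :: real and A :: algorithm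
  assume d: "d > 4" and \<eta>: "0 \<le> \<eta>" "\<eta> < 1/2" and \<epsilon>: "0 < \<epsilon>" "\<epsilon> \<le> 1 / (4 * pi)"
    and \<delta>: "0 < \<delta>" "\<delta> \<le> 1/4"
  define a where "a = real d * ln (1/\<epsilon>) / (1 - 2*\<eta>)\<^sup>2"
  define b where "b = \<eta> * ln (1/\<delta>) / (1 - 2*\<eta>)\<^sup>2"
  have "1 / (4 * pi) \<le> 1" using pi_ge_two by simp
  with \<epsilon> have "\<epsilon> \<le> 1" by linarith
  with \<epsilon> have "1 \<le> 1 / \<epsilon>" by simp
  then have a0: "0 \<le> a" unfolding a_def by (intro divide_nonneg_nonneg mult_nonneg_nonneg ln_ge_zero) auto
  have \<theta>: "0 < (1 - 2*\<eta>)\<^sup>2" using \<eta> by simp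
  obtain U where U: "finite U" "U \<subseteq> sphere_d d" "2 \<le> card U"
      "\<And>u u'. u \<in> U \<Longrightarrow> u' \<in> U \<Longrightarrow> u \<noteq> u' \<Longrightarrow> 2 * \<epsilon> < disagree d u u'"
      "real d * ln (1 / \<epsilon>) / 70 \<le> ln (real (card U))"
    using exists_packing[OF d \<epsilon>] by blast
  have "\<exists>u\<in>U. \<forall>n. 1 - \<delta> \<le> measure run_space (success_event d A (flip_oracle d \<eta> u) u \<epsilon> n) \<longrightarrow>
      1 / 1120 * (a + b) \<le> real n"
  \<comment> \<open>A single oracle must serve both terms, so the construction for the larger one is
    used, at the cost of a factor 2: \<open>1120 = 2 * 70 * 8\<close>.\<close>
  proof (cases "b \<le> a")
    case True
    have "1 / 1120 * (a + b) \<le> a / 560" using True by simp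
    also have "\<dots> = real d * ln (1 / \<epsilon>) / 70 / (8 * (1 - 2 * \<eta>)\<^sup>2)" by (simp add: a_def)
    also have "\<dots> \<le> ln (real (card U)) / (8 * (1 - 2 * \<eta>)\<^sup>2)"
      using U(5) by (intro divide_right_mono) auto
    finally show ?thesis
      using packing_query_bound[OF U(1,3,4) \<eta> \<delta>(2), of A] by (blast intro: order_trans)
  next
    case False
    then have "\<eta> \<noteq> 0" using a0 by (auto simp: b_def)
    then have \<eta>0: "0 < \<eta>" using \<eta> by simp
    obtain u0 u1 where u: "u0 \<in> U" "u1 \<in> U" "u0 \<noteq> u1"
      using U(3) by (auto simp: card_le_Suc_iff numeral_2_eq_2)
    have "1 / 1120 * (a + b) \<le> b / 4" using False a0 by simp
    also have "\<dots> = \<eta> * ln (1 / \<delta>) / (4 * (1 - 2 * \<eta>)\<^sup>2)" by (simp add: b_def)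
    finally have le: "1 / 1120 * (a + b) \<le> \<eta> * ln (1 / \<delta>) / (4 * (1 - 2 * \<eta>)\<^sup>2)" .
    obtain w where "w \<in> {u0, u1}" and
      w: "\<forall>n. 1 - \<delta> \<le> measure run_space (success_event d A (flip_oracle d \<eta> w) w \<epsilon> n) \<longrightarrow>
        \<eta> * ln (1 / \<delta>) / (4 * (1 - 2 * \<eta>)\<^sup>2) \<le> real n"
      using pair_query_bound[OF U(4)[OF u] \<eta>0 \<eta>(2) \<delta>, of A] by blast
    then have "w \<in> U" using u by auto
    with w le show ?thesis by (intro bexI[of _ w]) (auto intro: order_trans)
  qed
  then obtain u where "u \<in> U" and
    u: "\<forall>n. 1 - \<delta> \<le> measure run_space (success_event d A (flip_oracle d \<eta> u) u \<epsilon> n) \<longrightarrow>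
      1 / 1120 * (a + b) \<le> real n"
    by blast
  then show "\<exists>u \<in> sphere_d d. \<exists>p. bounded_noise_oracle d \<eta> u p \<and>
        (\<forall>n::nat. measure run_space (success_event d A p u \<epsilon> n) \<ge> 1 - \<delta> \<longrightarrow>
           real n \<ge> 1 / 1120 * (real d * ln (1/\<epsilon>) / (1 - 2*\<eta>)\<^sup>2
                        + \<eta> * ln (1/\<delta>) / (1 - 2*\<eta>)\<^sup>2))"
    unfolding a_def[symmetric] b_def[symmetric]
    using U(2) bounded_noise_flip_oracle[OF \<eta>, of d u] by blast
qed simp

end
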